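(* Assume $\alpha>C$. Then there exists a unique quasi-stationary distribution $\nu$ for $Q$, and for every probability measure $\mu$ on $\Lambda$ the Yaglom limit converges to $\nu$, that is, $$\lim_{t\to\infty}\varphi^{\mu}_t(y)=\nu(y)\qquad\text{for all } y\in\Lambda .$$
   Context: Let $\Lambda$ be a countable set, $0\notin\Lambda$, and let $(Z_t)_{t\ge 0}$ be a pure jump regular (non-explosive) continuous-time Markov process on $\Lambda\cup\{0\}$ with transition rates matrix $Q=(q(x,y))$ and transition probabilities $P_t(x,y)$, with $0$ absorbing: $q(0,x)=0$ for all $x\in\Lambda$. Convention: $q(x,x)=-\sum_{y\in(\Lambda\cup\{0\})\setminus\{x\}}q(x,y)$. Standing assumptions: $\bar q:=\sup_{x\in\Lambda}\sum_{y\in(\Lambda\cup\{0\})\setminus\{x\}}q(x,y)<\infty$; $P_t(x,y)>0$ for all $x,y\in\Lambda$ and $t>0$; the absorption time at $0$ is almost surely finite for every initial state. Ergodicity coefficient and maximal absorbing rate: $$\alpha:=\sum_{z\in\Lambda}\ \inf_{x\in\Lambda\setminus\{z\}}q(x,z),\qquad C:=\sup_{x\in\Lambda}q(x,0)$$ (with $\inf\emptyset=+\infty$). For a probability measure $\mu$ on $\Lambda$, the law at time $t$ of the process started from $\mu$ and conditioned on non-absorption until time $t$ is $$\varphi^\mu_t(x)=\frac{\sum_{y\in\Lambda}\mu(y)P_t(y,x)}{1-\sum_{y\in\Lambda}\mu(y)P_t(y,0)},\qquad x\in\Lambda.$$ A quasi-stationary distribution for $Q$ is a probability measure $\nu$ on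 $\Lambda$ with $\varphi^\nu_t=\nu$ for all $t\ge 0$. The Yaglom limit for $\mu$ is $\lim_{t\to\infty}\varphi^\mu_t(y)$, $y\in\Lambda$, if the limit exists and is a probability on $\Lambda$. *)

theory Defs
  imports "HOL-Probability.Probability"
begin

text \<open>
  A process with state space \<open>E\<close> is given by its canonical family of laws: \<open>Pr x\<close> is the law
  under which the process \<open>Z\<close> starts from \<open>x\<close>. Times are the non-negative reals; the values
  of \<open>Z t\<close> for \<open>t < 0\<close> play no role.
\<close>

definition trans_prob :: "('a \<Rightarrow> 'w measure) \<Rightarrow> (real \<Rightarrow> 'w \<Rightarrow> 'a) \<Rightarrow> real \<Rightarrow> 'a \<Rightarrow> 'a \<Rightarrow> real" where
  "trans_prob Pr Z t x y = \<P>(\<omega> in Pr x. Z t \<omega> = y)"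

text \<open>
  The path is right-continuous (for the discrete topology) with finitely many jumps in
  every bounded time interval. The \<open>\<tau> n\<close> need not all be genuine jump times, so paths that
  are eventually constant are included.
\<close>

definition nonexplosive_step_path :: "(real \<Rightarrow> 'a) \<Rightarrow> bool" where
  "nonexplosive_step_path f \<longleftrightarrow>
     (\<exists>\<tau> :: nat \<Rightarrow> real. \<tau> 0 = 0 \<and> strict_mono \<tau> \<and> filterlim \<tau> at_top sequentially \<and>
        (\<forall>n. \<forall>t\<in>{\<tau> n..<\<tau> (Suc n)}. f t = f (\<tau> n)))"

text \<open>
  The last clause is the (time-homogeneous) Markov property: \<open>F\<close> is a finite set of
  observation times, the latest of which is the present \<open>s\<close>.
\<close>

definition regular_jump_markov_process ::
    "'a set \<Rightarrow> ('a \<Rightarrow> 'w measure) \<Rightarrow> (real \<Rightarrow> 'w \<Rightarrow> 'a) \<Rightarrow> bool" where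
  "regular_jump_markov_process E Pr Z \<longleftrightarrow>
     (\<forall>x\<in>E. prob_space (Pr x)) \<and>
     (\<forall>x\<in>E. \<forall>t\<ge>0. Z t \<in> measurable (Pr x) (count_space E)) \<and>
     (\<forall>x\<in>E. AE \<omega> in Pr x. Z 0 \<omega> = x) \<and>
     (\<forall>x\<in>E. AE \<omega> in Pr x. nonexplosive_step_path (\<lambda>t. Z t \<omega>)) \<and>
     (\<forall>x\<in>E. \<forall>s\<ge>0. \<forall>t\<ge>0. \<forall>F a. \<forall>y\<in>E.
        finite F \<and> F \<subseteq> {0..s} \<and> s \<in> F \<and> \<P>(\<omega> in Pr x. \<forall>u\<in>F. Z u \<omega> = a u) > 0 \<longrightarrow>
        \<P>(\<omega> in Pr x. Z (s + t) \<omega> = y \<bar> \<forall>u\<in>F. Z u \<omega> = a u) = trans_prob Pr Z t (a s) y)"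

text \<open>
  \<open>Q\<close> is the entrywise right derivative at time \<open>0\<close> of the transition probabilities,
  with the convention on the diagonal. The real-valued infinite sum is meaningful only for
  rows with summable off-diagonal entries; finiteness of \<open>max_exit_rate\<close> below provides this.
\<close>

definition transition_rates ::
    "'a set \<Rightarrow> ('a \<Rightarrow> 'w measure) \<Rightarrow> (real \<Rightarrow> 'w \<Rightarrow> 'a) \<Rightarrow> ('a \<Rightarrow> 'a \<Rightarrow> real) \<Rightarrow> bool" where
  "transition_rates E Pr Z q \<longleftrightarrow>
     (\<forall>x\<in>E. \<forall>y\<in>E. ((\<lambda>t. trans_prob Pr Z t x y) has_real_derivative q x y) (at 0 within {0..})) \<and>
     (\<forall>x\<in>E. q x x = - (\<Sum>\<^sub>\<infinity>y\<in>E - {x}. q x y))"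

definition absorption_time :: "'a \<Rightarrow> (real \<Rightarrow> 'w \<Rightarrow> 'a) \<Rightarrow> 'w \<Rightarrow> ereal" where
  "absorption_time c Z \<omega> = (INF t\<in>{t. 0 \<le> t \<and> Z t \<omega> = c}. ereal t)"

text \<open>
  In what follows \<open>L\<close> is the set of non-absorbed states and \<open>c\<close> is the absorbing state.
  Off-diagonal rates are non-negative, so nothing is lost by passing to \<^typ>\<open>ennreal\<close>, where
  the infimum of the empty set is \<open>\<infinity>\<close>.
\<close>

definition max_exit_rate :: "'a set \<Rightarrow> 'a \<Rightarrow> ('a \<Rightarrow> 'a \<Rightarrow> real) \<Rightarrow> ennreal" where
  "max_exit_rate L c q = (SUP x\<in>L. \<Sum>\<^sub>\<infinity>y\<in>insert c L - {x}. ennreal (q x y))"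

definition ergodicity_coeff :: "'a set \<Rightarrow> ('a \<Rightarrow> 'a \<Rightarrow> real) \<Rightarrow> ennreal" where
  "ergodicity_coeff L q = (\<Sum>\<^sub>\<infinity>z\<in>L. INF x\<in>L - {z}. ennreal (q x z))"

definition max_absorbing_rate :: "'a set \<Rightarrow> 'a \<Rightarrow> ('a \<Rightarrow> 'a \<Rightarrow> real) \<Rightarrow> ennreal" where
  "max_absorbing_rate L c q = (SUP x\<in>L. ennreal (q x c))"

definition conditioned_law ::
    "'a set \<Rightarrow> 'a \<Rightarrow> (real \<Rightarrow> 'a \<Rightarrow> 'a \<Rightarrow> real) \<Rightarrow> 'a pmf \<Rightarrow> real \<Rightarrow> 'a \<Rightarrow> real" where
  "conditioned_law L c P \<mu> t x =
     (\<Sum>\<^sub>\<infinity>y\<in>L. pmf \<mu> y * P t y x) / (1 - (\<Sum>\<^sub>\<infinity>y\<in>L. pmf \<mu> y * P t y c))"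

definition quasi_stationary ::
    "'a set \<Rightarrow> 'a \<Rightarrow> (real \<Rightarrow> 'a \<Rightarrow> 'a \<Rightarrow> real) \<Rightarrow> 'a pmf \<Rightarrow> bool" where
  "quasi_stationary L c P \<nu> \<longleftrightarrow>
     set_pmf \<nu> \<subseteq> L \<and> (\<forall>t\<ge>0. \<forall>x\<in>L. conditioned_law L c P \<nu> t x = pmf \<nu> x)"

definition yaglom_limit ::
    "'a set \<Rightarrow> 'a \<Rightarrow> (real \<Rightarrow> 'a \<Rightarrow> 'a \<Rightarrow> real) \<Rightarrow> 'a pmf \<Rightarrow> 'a pmf \<Rightarrow> bool" where
  "yaglom_limit L c P \<mu> \<nu> \<longleftrightarrow>
     set_pmf \<nu> \<subseteq> L \<and> (\<forall>y\<in>L. ((\<lambda>t. conditioned_law L c P \<mu> t y) \<longlongrightarrow> pmf \<nu> y) at_top)"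

end

theory Submission
  imports Defs
begin

text \<open>
  Let \<open>\<phi> t \<mu>\<close> be the law at time \<open>t\<close>, started from \<open>\<mu>\<close> and conditioned on non-absorption. These maps
  form a semigroup of nonlinear maps on the laws on \<open>L\<close>, and a quasi-stationary distribution is a
  common fixed point. The hypothesis makes \<open>\<phi> h\<close>, for one small \<open>h\<close>, a strict contraction in total
  variation. This gives at once a unique fixed point that attracts every starting law.

  The contraction is a Doeblin argument that takes account of the conditioning. Suppose that from every state
  in \<open>L\<close> the kernel at time \<open>h\<close> has a common part of mass \<open>B\<close> in \<open>L\<close>, and loses at most
  \<open>\<epsilon>\<close> to the absorbing state. The common part cannot distinguish two starting laws, which leaves a
  factor \<open>1 - B\<close>, and renormalising by the surviving mass costs a factor \<open>1 / (1 - \<epsilon>)\<close>. So the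
  distance shrinks by \<open>(1 - B) / (1 - \<epsilon>)\<close>, which is less than one exactly when \<open>B > \<epsilon>\<close>
  (\<open>survivors_contraction\<close>). Iterating this and using that laws are complete in total variation
  yields the limit (\<open>tv_cauchy_pmf_limit\<close>, \<open>quasi_limiting_law\<close>).

  It remains to see that \<open>B > \<epsilon>\<close> for small \<open>h\<close>. A finite part of the ergodicity coefficient already
  exceeds the maximal absorbing rate (\<open>finite_minorant_of_rates\<close>); to first order \<open>B\<close> is \<open>h\<close> times
  the former and \<open>\<epsilon>\<close> is \<open>h\<close> times the latter. But the rates are only entrywise derivatives,
  and the comparison has to hold uniformly in the state. Superadditivity
  turns derivatives at zero into lower bounds valid for all times: diagonal entries
  are at least \<open>exp (t * q x x)\<close> and off-diagonal ones at least \<open>t * exp (- (b * t)) * q x z\<close>, where \<open>b\<close>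
  bounds the exit rates (\<open>diag_ge_exp\<close>, \<open>off_diag_ge\<close>). As each row of probabilities sums
  to one and each row of rates to zero, these lower bounds force the upper bound
  \<open>h * q x c + h\<^sup>2 * b\<^sup>2\<close> on the absorption probability (\<open>hitting_prob_le\<close>).
\<close>

section \<open>Expectations of bounded functions\<close>

lemma integrable_pmf_bounded:
  fixes f :: "'a \<Rightarrow> real"
  assumes "\<And>x. x \<in> set_pmf p \<Longrightarrow> \<bar>f x\<bar> \<le> B"
  shows "integrable (measure_pmf p) f"
  by (rule measure_pmf.integrable_const_bound[where B = B]) (auto simp: AE_measure_pmf_iff assms)

lemma expectation_pmf_abs_le:
  fixes f :: "'a \<Rightarrow> real"
  assumes "\<And>x. x \<in> set_pmf p \<Longrightarrow> \<bar>f x\<bar> \<le> B"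
  shows "\<bar>measure_pmf.expectation p f\<bar> \<le> B"
proof -
  have int: "integrable (measure_pmf p) f"
    by (rule integrable_pmf_bounded[OF assms])
  have "measure_pmf.expectation p f \<le> B"
    by (rule measure_pmf.integral_le_const[OF int]) (use assms in \<open>auto simp: AE_measure_pmf_iff abs_le_iff minus_le_iff\<close>)
  moreover have "measure_pmf.expectation p f \<ge> - B"
    by (rule measure_pmf.integral_ge_const[OF int]) (use assms in \<open>auto simp: AE_measure_pmf_iff abs_le_iff minus_le_iff\<close>)
  ultimately show ?thesis by simp
qed

lemma expectation_pmf_cong:
  assumes "\<And>x. x \<in> set_pmf p \<Longrightarrow> f x = g x"
  shows "measure_pmf.expectation p f = measure_pmf.expectation p g"
  by (rule integral_cong_AE) (auto simp: AE_measure_pmf_iff assms)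

lemma expectation_pmf_infsum:
  fixes f :: "'a \<Rightarrow> real"
  assumes supp: "set_pmf p \<subseteq> L" and f: "\<And>x. \<bar>f x\<bar> \<le> B"
  shows "measure_pmf.expectation p f = (\<Sum>\<^sub>\<infinity>x\<in>L. pmf p x * f x)"
proof -
  have "integrable (measure_pmf p) f" by (rule integrable_pmf_bounded[OF f])
  then have "Infinite_Set_Sum.abs_summable_on (\<lambda>x. pmf p x * f x) UNIV"
    unfolding Infinite_Set_Sum.abs_summable_on_def measure_pmf_eq_density
    by (subst (asm) integrable_density) auto
  then have "measure_pmf.expectation p f = (\<Sum>\<^sub>\<infinity>x\<in>UNIV. pmf p x * f x)"
    by (simp add: pmf_expectation_eq_infsetsum infsetsum_infsum)
  also have "\<dots> = (\<Sum>\<^sub>\<infinity>x\<in>L. pmf p x * f x)"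
    using supp by (intro infsum_cong_neutral) (auto simp: set_pmf_iff)
  finally show ?thesis .
qed

lemma expectation_bind_pmf_bounded:
  fixes f :: "'b \<Rightarrow> real"
  assumes f: "\<And>x. \<bar>f x\<bar> \<le> B"
  shows "measure_pmf.expectation (bind_pmf p k) f =
         measure_pmf.expectation p (\<lambda>x. measure_pmf.expectation (k x) f)"
proof -
  have nonneg_case: "measure_pmf.expectation (bind_pmf p k) g =
      measure_pmf.expectation p (\<lambda>x. measure_pmf.expectation (k x) g)"
    if g: "\<And>x. 0 \<le> g x" "\<And>x. g x \<le> C" for g :: "'b \<Rightarrow> real" and C
  proof -
    have int: "integrable (measure_pmf q) g" for q
      by (rule integrable_pmf_bounded[where B = C]) (use g in auto)
    have nn: "(\<integral>\<^sup>+x. ennreal (g x) \<partial>measure_pmf q) = ennreal (measure_pmf.expectation q g)" for q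
      by (rule nn_integral_eq_integral[OF int]) (use g in auto)
    have int2: "integrable (measure_pmf p) (\<lambda>x. measure_pmf.expectation (k x) g)"
      by (rule integrable_pmf_bounded[where B = C])
         (intro expectation_pmf_abs_le, use g in auto)
    have "ennreal (measure_pmf.expectation (bind_pmf p k) g) =
          (\<integral>\<^sup>+x. ennreal (measure_pmf.expectation (k x) g) \<partial>measure_pmf p)"
      by (simp add: nn[symmetric])
    also have "\<dots> = ennreal (measure_pmf.expectation p (\<lambda>x. measure_pmf.expectation (k x) g))"
      by (rule nn_integral_eq_integral[OF int2]) (use g in \<open>auto intro!: integral_nonneg_AE\<close>)
    finally show ?thesis
      by (subst (asm) ennreal_inj) (use g in \<open>auto intro!: integral_nonneg_AE\<close>)
  qed
  have int: "integrable (measure_pmf q) f" for q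
    by (rule integrable_pmf_bounded[OF f])
  have "measure_pmf.expectation (k x) (\<lambda>y. f y + B) = measure_pmf.expectation (k x) f + B" for x
    using int by simp
  moreover have "integrable (measure_pmf p) (\<lambda>x. measure_pmf.expectation (k x) f)"
    by (rule integrable_pmf_bounded[where B = B]) (rule expectation_pmf_abs_le[OF f])
  moreover have "measure_pmf.expectation (bind_pmf p k) (\<lambda>y. f y + B) =
      measure_pmf.expectation p (\<lambda>x. measure_pmf.expectation (k x) (\<lambda>y. f y + B))"
  proof (rule nonneg_case)
    show "0 \<le> f y + B" for y using f[of y] by linarith
    show "f y + B \<le> 2 * B" for y using f[of y] by linarith
  qed
  ultimately show ?thesis
    using int by simp
qed

lemma expectation_cond_pmf_bounded:
  fixes f :: "'a \<Rightarrow> real"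
  assumes ne: "set_pmf p \<inter> S \<noteq> {}" and f: "\<And>x. \<bar>f x\<bar> \<le> B"
  shows "measure_pmf.expectation (cond_pmf p S) f * measure_pmf.prob p S =
         measure_pmf.expectation p (\<lambda>x. indicator S x * f x)"
proof -
  have pos: "measure_pmf.prob p S \<noteq> 0"
    using ne by (simp add: measure_pmf_zero_iff)
  have "measure_pmf.expectation (cond_pmf p S) f =
      (\<integral>x. pmf (cond_pmf p S) x * f x \<partial>count_space UNIV)"
    unfolding measure_pmf_eq_density by (subst integral_density) auto
  also have "\<dots> = (\<integral>x. (pmf p x * (indicator S x * f x)) / measure_pmf.prob p S \<partial>count_space UNIV)"
    by (rule Bochner_Integration.integral_cong) (auto simp: pmf_cond[OF ne] indicator_def)
  also have "\<dots> = (\<integral>x. pmf p x * (indicator S x * f x) \<partial>count_space UNIV) / measure_pmf.prob p S"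
    by simp
  also have "(\<integral>x. pmf p x * (indicator S x * f x) \<partial>count_space UNIV) =
      measure_pmf.expectation p (\<lambda>x. indicator S x * f x)"
    unfolding measure_pmf_eq_density by (subst integral_density) auto
  finally show ?thesis using pos by simp
qed

lemma sum_le_expectation_pmf:
  fixes h :: "'a \<Rightarrow> real"
  assumes "finite F" and "\<And>z. z \<in> F \<Longrightarrow> \<beta> z \<le> pmf p z"
    and "\<And>x. 0 \<le> h x" and "\<And>x. h x \<le> B"
  shows "(\<Sum>z\<in>F. \<beta> z * h z) \<le> measure_pmf.expectation p h"
proof -
  have nonneg_B: "0 \<le> B"
    using assms(3,4)[of undefined] by linarith
  have "(\<Sum>z\<in>F. \<beta> z * h z) \<le> (\<Sum>z\<in>F. pmf p z * h z)"
    by (intro sum_mono mult_right_mono assms)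
  also have "\<dots> = measure_pmf.expectation p (\<lambda>x. indicator F x * h x)"
    by (subst integral_measure_pmf[OF assms(1)]) (auto simp: indicator_def)
  also have "\<dots> \<le> measure_pmf.expectation p h"
    by (intro integral_mono integrable_pmf_bounded[where B = B])
       (use assms(3,4) nonneg_B in \<open>auto simp: indicator_def\<close>)
  finally show ?thesis .
qed

section \<open>Total variation distance\<close>

text \<open>
  Total variation distance at most \<open>d\<close>, tested against functions with values in \<open>[0, 1]\<close>
  instead of events: the contraction argument applies the bound to an expectation of a
  transition kernel, which is no longer an indicator.
\<close>

definition tv_close :: "'a pmf \<Rightarrow> 'a pmf \<Rightarrow> real \<Rightarrow> bool" where
  "tv_close \<mu> \<nu> d \<longleftrightarrow>
     (\<forall>f :: 'a \<Rightarrow> real. (\<forall>x. 0 \<le> f x \<and> f x \<le> 1) \<longrightarrow>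
        \<bar>measure_pmf.expectation \<mu> f - measure_pmf.expectation \<nu> f\<bar> \<le> d)"

lemma tv_close_1: "tv_close \<mu> \<nu> 1"
  unfolding tv_close_def
proof safe
  fix f :: "'a \<Rightarrow> real" assume f: "\<forall>x. 0 \<le> f x \<and> f x \<le> 1"
  have "0 \<le> measure_pmf.expectation p f" "measure_pmf.expectation p f \<le> 1" for p
    using f by (auto intro!: integral_nonneg_AE measure_pmf.integral_le_const
        integrable_pmf_bounded[where B = 1])
  from this[of \<mu>] this[of \<nu>]
  show "\<bar>measure_pmf.expectation \<mu> f - measure_pmf.expectation \<nu> f\<bar> \<le> 1"
    by linarith
qed

lemma tv_close_prob:
  assumes "tv_close \<mu> \<nu> d"
  shows "\<bar>measure_pmf.prob \<mu> A - measure_pmf.prob \<nu> A\<bar> \<le> d"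
proof -
  have "\<bar>measure_pmf.expectation \<mu> (indicator A) - measure_pmf.expectation \<nu> (indicator A)\<bar> \<le> d"
    using assms[unfolded tv_close_def, rule_format, of "indicator A"] by simp
  then show ?thesis by simp
qed

text \<open>
  An affine change of variables carries \<open>g\<close> into \<open>[0, 1]\<close> on \<open>L\<close>, and the additive constant
  drops out because both measures have mass one. Thus only the oscillation of \<open>g\<close> matters,
  which is what lets a constant be subtracted from \<open>g\<close> for free.
\<close>

lemma tv_close_oscillation:
  fixes g :: "'a \<Rightarrow> real"
  assumes tv: "tv_close \<mu> \<nu> d" and supp: "set_pmf \<mu> \<subseteq> L" "set_pmf \<nu> \<subseteq> L"
    and g: "\<And>x. x \<in> L \<Longrightarrow> a \<le> g x" "\<And>x. x \<in> L \<Longrightarrow> g x \<le> a + b"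
  shows "\<bar>measure_pmf.expectation \<mu> g - measure_pmf.expectation \<nu> g\<bar> \<le> b * d"
proof -
  have "0 \<le> b"
  proof -
    obtain x where "x \<in> L" using set_pmf_not_empty[of \<mu>] supp by blast
    from g[OF this] show ?thesis by linarith
  qed
  define f where "f x = (if x \<in> L then (g x - a) / b else 0)" for x
  have f: "0 \<le> f x \<and> f x \<le> 1" for x
    using g[of x] \<open>0 \<le> b\<close> by (auto simp: f_def divide_simps)
  have g_eq: "g x = a + b * f x" if "x \<in> L" for x
    using g[OF that] that by (cases "b = 0") (auto simp: f_def)
  have E: "measure_pmf.expectation p g = a + b * measure_pmf.expectation p f" if "set_pmf p \<subseteq> L" for p
  proof -
    have "measure_pmf.expectation p g = measure_pmf.expectation p (\<lambda>x. a + b * f x)"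
      using that g_eq by (intro expectation_pmf_cong) auto
    moreover have "integrable (measure_pmf p) f"
      by (rule integrable_pmf_bounded[where B = 1]) (use f in auto)
    ultimately show ?thesis by simp
  qed
  have "\<bar>measure_pmf.expectation \<mu> g - measure_pmf.expectation \<nu> g\<bar> =
      b * \<bar>measure_pmf.expectation \<mu> f - measure_pmf.expectation \<nu> f\<bar>"
    using \<open>0 \<le> b\<close> by (simp add: E supp abs_mult flip: right_diff_distrib)
  also have "\<dots> \<le> b * d"
    using tv f \<open>0 \<le> b\<close> unfolding tv_close_def by (intro mult_left_mono) auto
  finally show ?thesis .
qed

section \<open>Contraction under conditioning on survival\<close>

text \<open>
  One step of the conditioned evolution. When no mass survives the value is arbitrary, since
  \<^const>\<open>cond_pmf\<close> is then unspecified.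
\<close>

definition survivors :: "('a \<Rightarrow> 'a pmf) \<Rightarrow> 'a \<Rightarrow> 'a pmf \<Rightarrow> 'a pmf" where
  "survivors k c \<mu> = cond_pmf (bind_pmf \<mu> k) (- {c})"

text \<open>
  The sub-Markov operator of \<open>k\<close> restricted to the complement of \<open>c\<close>, acting on functions.
\<close>

definition killed :: "('a \<Rightarrow> 'a pmf) \<Rightarrow> 'a \<Rightarrow> ('a \<Rightarrow> real) \<Rightarrow> 'a \<Rightarrow> real" where
  "killed k c f x = measure_pmf.expectation (k x) (\<lambda>y. indicator (- {c}) y * f y)"

lemma killed_abs_le:
  assumes "\<And>x. \<bar>f x\<bar> \<le> B" and "0 \<le> B"
  shows "\<bar>killed k c f x\<bar> \<le> B"
  unfolding killed_def by (rule expectation_pmf_abs_le) (use assms in \<open>auto simp: indicator_def\<close>)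

lemma killed_one: "killed k c (\<lambda>_. 1) x = 1 - pmf (k x) c"
  using measure_pmf.prob_compl[of "{c}" "k x"]
  by (simp add: killed_def Compl_eq_Diff_UNIV measure_pmf_single)

text \<open>
  This is the side condition under which \<^const>\<open>cond_pmf\<close> is specified in \<^const>\<open>survivors\<close>.
\<close>

lemma bind_pmf_survives:
  assumes "set_pmf \<mu> \<subseteq> L" and "\<And>x. x \<in> L \<Longrightarrow> pmf (k x) c < 1"
  shows "set_pmf (bind_pmf \<mu> k) \<inter> - {c} \<noteq> {}"
proof -
  obtain x where x: "x \<in> set_pmf \<mu>" using set_pmf_not_empty[of \<mu>] by blast
  have "set_pmf (k x) \<inter> - {c} \<noteq> {}"
  proof
    assume "set_pmf (k x) \<inter> - {c} = {}"
    then have "k x = return_pmf c" by (auto simp flip: set_pmf_subset_singleton)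
    then show False using assms x by force
  qed
  with x show ?thesis by auto
qed

text \<open>
  The conditioned law is the ratio of two linear functionals of \<open>\<mu>\<close>. Written as a product, so that
  it can be used without division until the normalisation has been compared.
\<close>

lemma expectation_survivors:
  fixes f :: "'a \<Rightarrow> real"
  assumes supp: "set_pmf \<mu> \<subseteq> L" and surv: "\<And>x. x \<in> L \<Longrightarrow> pmf (k x) c < 1"
    and f: "\<And>x. \<bar>f x\<bar> \<le> B"
  shows "measure_pmf.expectation (survivors k c \<mu>) f * measure_pmf.expectation \<mu> (killed k c (\<lambda>_. 1)) =
         measure_pmf.expectation \<mu> (killed k c f)"
proof -
  have "0 \<le> B" using f[of undefined] by linarith
  have "measure_pmf.expectation \<mu> (killed k c (\<lambda>_. 1)) =
      measure_pmf.expectation (bind_pmf \<mu> k) (indicator (- {c}))"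
    by (subst expectation_bind_pmf_bounded[where B = 1])
       (auto simp: killed_def[abs_def] indicator_def[abs_def])
  moreover have "measure_pmf.expectation \<mu> (killed k c f) =
      measure_pmf.expectation (bind_pmf \<mu> k) (\<lambda>y. indicator (- {c}) y * f y)"
    by (subst expectation_bind_pmf_bounded[where B = B])
       (use f \<open>0 \<le> B\<close> in \<open>auto simp: indicator_def killed_def[abs_def]\<close>)
  moreover note expectation_cond_pmf_bounded[OF bind_pmf_survives[OF supp surv] f]
  ultimately show ?thesis
    by (simp add: survivors_def)
qed

lemma expectation_killed_one_pos:
  assumes supp: "set_pmf \<mu> \<subseteq> L" and surv: "\<And>x. x \<in> L \<Longrightarrow> pmf (k x) c < 1"
  shows "0 < measure_pmf.expectation \<mu> (killed k c (\<lambda>_. 1))"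
  using supp surv
  by (intro measure_pmf.expectation_greater integrable_pmf_bounded[where B = 1])
     (auto simp: killed_one AE_measure_pmf_iff pmf_le_1 subset_iff)

text \<open>
  Let \<open>m\<close> be the mean of \<open>f\<close> under the conditioned law of \<open>\<nu>\<close> and let \<open>G\<close> be the killed operator
  applied to \<open>f - m\<close>. Subtracting \<open>m\<close> linearises the normalisation: the mean of \<open>G\<close> vanishes under
  \<open>\<nu>\<close>, and under \<open>\<mu>\<close> it is the difference to be estimated times the surviving mass, which is at
  least \<open>1 - \<epsilon>\<close>. On the other hand the part \<open>\<beta>\<close> common to all rows contributes the same constant
  \<open>w\<close> to every \<open>G x\<close>, and the remaining mass \<open>1 - sum \<beta> F\<close>, killed or not, moves \<open>G x - w\<close>
  inside an interval of length \<open>1 - sum \<beta> F\<close>. Killing does not widen this interval because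
  \<open>0\<close> lies between the extreme values \<open>- m\<close> and \<open>1 - m\<close> of \<open>f - m\<close>.
\<close>

theorem survivors_contraction:
  assumes F: "finite F" "c \<notin> F"
    and minor: "\<And>x z. x \<in> L \<Longrightarrow> z \<in> F \<Longrightarrow> \<beta> z \<le> pmf (k x) z"
    and kill: "\<And>x. x \<in> L \<Longrightarrow> pmf (k x) c \<le> \<epsilon>" and "\<epsilon> < 1"
    and supp: "set_pmf \<mu> \<subseteq> L" "set_pmf \<nu> \<subseteq> L" and tv: "tv_close \<mu> \<nu> d"
  shows "tv_close (survivors k c \<mu>) (survivors k c \<nu>) ((1 - sum \<beta> F) / (1 - \<epsilon>) * d)"
  unfolding tv_close_def
proof safe
  fix f :: "'a \<Rightarrow> real" assume f: "\<forall>x. 0 \<le> f x \<and> f x \<le> 1"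
  have surv: "pmf (k x) c < 1" if "x \<in> L" for x
    using kill[OF that] \<open>\<epsilon> < 1\<close> by simp
  let ?E = measure_pmf.expectation
  define m where "m = ?E (survivors k c \<nu>) f"
  have m: "0 \<le> m" "m \<le> 1"
    using f unfolding m_def by (auto intro!: integral_nonneg_AE measure_pmf.integral_le_const
        integrable_pmf_bounded[where B = 1])
  define G where "G = killed k c (\<lambda>x. f x - m)"
  define w where "w = (\<Sum>z\<in>F. \<beta> z * (f z - m))"
  have fm: "\<bar>f x - m\<bar> \<le> 1" for x
    using f m by (smt (verit) abs_le_iff)
  have E_G: "?E p G = (?E (survivors k c p) f - m) * ?E p (killed k c (\<lambda>_. 1))"
    if "set_pmf p \<subseteq> L" for p
  proof -
    have "?E (survivors k c p) (\<lambda>x. f x - m) = ?E (survivors k c p) f - m"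
      using f by (subst Bochner_Integration.integral_diff)
        (auto intro!: integrable_pmf_bounded[where B = 1])
    with expectation_survivors[where k = k and c = c and f = "\<lambda>x. f x - m", OF that surv fm] show ?thesis
      by (simp add: G_def)
  qed
  \<comment> \<open>Shifting by \<open>m\<close> makes the integrand nonnegative, so that the mass outside the minorant can be dropped.\<close>
  have low: "w - m * (1 - sum \<beta> F) \<le> G x" if x: "x \<in> L" for x
  proof -
    have "(\<Sum>z\<in>F. \<beta> z * (indicator (- {c}) z * (f z - m) + m)) \<le>
        ?E (k x) (\<lambda>z. indicator (- {c}) z * (f z - m) + m)"
      by (rule sum_le_expectation_pmf[where B = 1])
         (use F minor[OF x] f m in \<open>auto simp: indicator_def\<close>)
    also have "\<dots> = G x + m"
      unfolding G_def killed_def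
      by (subst Bochner_Integration.integral_add)
         (use fm in \<open>auto intro!: integrable_pmf_bounded[where B = 1] simp: indicator_def\<close>)
    also have "(\<Sum>z\<in>F. \<beta> z * (indicator (- {c}) z * (f z - m) + m)) = w + m * sum \<beta> F"
      using \<open>c \<notin> F\<close> unfolding w_def sum_distrib_left sum.distrib[symmetric]
      by (intro sum.cong) (auto simp: indicator_def algebra_simps)
    finally show ?thesis by (simp add: algebra_simps)
  qed
  have up: "G x \<le> w + (1 - m) * (1 - sum \<beta> F)" if x: "x \<in> L" for x
  proof -
    have "(\<Sum>z\<in>F. \<beta> z * ((1 - m) - indicator (- {c}) z * (f z - m))) \<le>
        ?E (k x) (\<lambda>z. (1 - m) - indicator (- {c}) z * (f z - m))"
      by (rule sum_le_expectation_pmf[where B = 1])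
         (use F minor[OF x] f m in \<open>auto simp: indicator_def\<close>)
    also have "\<dots> = (1 - m) - G x"
      unfolding G_def killed_def
      by (subst Bochner_Integration.integral_diff)
         (use fm in \<open>auto intro!: integrable_pmf_bounded[where B = 1] simp: indicator_def\<close>)
    also have "(\<Sum>z\<in>F. \<beta> z * ((1 - m) - indicator (- {c}) z * (f z - m))) = (1 - m) * sum \<beta> F - w"
      using \<open>c \<notin> F\<close> unfolding w_def sum_distrib_left sum_subtractf[symmetric]
      by (intro sum.cong) (auto simp: indicator_def algebra_simps)
    finally show ?thesis by (simp add: algebra_simps)
  qed
  have "\<bar>?E \<mu> G - ?E \<nu> G\<bar> \<le> (1 - sum \<beta> F) * d"
    by (rule tv_close_oscillation[OF tv supp, where a = "w - m * (1 - sum \<beta> F)"])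
       (use low up in \<open>auto simp: algebra_simps\<close>)
  also have "?E \<nu> G = 0"
    by (simp add: E_G supp m_def)
  finally have bound: "\<bar>?E (survivors k c \<mu>) f - m\<bar> * \<bar>?E \<mu> (killed k c (\<lambda>_. 1))\<bar> \<le> (1 - sum \<beta> F) * d"
    by (simp add: E_G supp abs_mult)
  have "1 - \<epsilon> \<le> ?E \<mu> (killed k c (\<lambda>_. 1))"
    using kill supp
    by (intro measure_pmf.integral_ge_const integrable_pmf_bounded[where B = 1])
       (auto simp: killed_one AE_measure_pmf_iff pmf_le_1 subset_iff)
  then have "\<bar>?E (survivors k c \<mu>) f - m\<bar> * (1 - \<epsilon>) \<le>
      \<bar>?E (survivors k c \<mu>) f - m\<bar> * \<bar>?E \<mu> (killed k c (\<lambda>_. 1))\<bar>"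
    by (intro mult_left_mono) auto
  with bound have "\<bar>?E (survivors k c \<mu>) f - m\<bar> * (1 - \<epsilon>) \<le> (1 - sum \<beta> F) * d"
    by linarith
  with \<open>\<epsilon> < 1\<close> show "\<bar>?E (survivors k c \<mu>) f - ?E (survivors k c \<nu>) f\<bar> \<le>
      (1 - sum \<beta> F) / (1 - \<epsilon>) * d"
    by (simp add: m_def field_simps)
qed

section \<open>Limits of laws in total variation\<close>

text \<open>
  Tightness of a single law, to keep mass from escaping in a limit of laws.
\<close>

lemma finite_set_carrying_pmf:
  assumes "0 < e"
  obtains F where "finite F" "1 - e < measure_pmf.prob p F"
proof -
  have "(pmf p has_sum 1) UNIV"
    using infsetsum_infsum[OF pmf_abs_summable, of p UNIV] pmf_abs_summable[of p UNIV]
      infsetsum_pmf_eq_1[of p UNIV]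
    by (metis abs_summable_equivalent abs_summable_summable has_sum_infsum subset_UNIV)
  then have "\<forall>\<^sub>F F in finite_subsets_at_top UNIV. 1 - e < sum (pmf p) F"
    unfolding has_sum_def using assms by (intro order_tendstoD(1)) auto
  then obtain F where "finite F" "1 - e < sum (pmf p) F"
    unfolding eventually_finite_subsets_at_top by blast
  then show ?thesis
    using that by (simp add: measure_measure_pmf_finite)
qed

text \<open>
  Completeness of total variation. The pointwise limit \<open>l\<close> of the densities has mass at most one by
  Fatou. It has mass one because a finite set carrying almost all of one \<open>\<mu> n\<close> carries almost all of
  every later \<open>\<mu> m\<close>, by the uniform Cauchy bound. Convergence of expectations follows from Fatou
  for \<open>f\<close> and for \<open>1 - f\<close>, which give the two inequalities.
\<close>

lemma tv_cauchy_pmf_limit: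
  fixes \<mu> :: "nat \<Rightarrow> 'a pmf"
  assumes cauchy: "\<And>n m. n \<le> m \<Longrightarrow> tv_close (\<mu> n) (\<mu> m) (b n)" and b: "b \<longlonglongrightarrow> 0"
  shows "\<exists>\<nu>. \<forall>f B. (\<forall>x. \<bar>f x :: real\<bar> \<le> B) \<longrightarrow>
      (\<lambda>n. measure_pmf.expectation (\<mu> n) f) \<longlonglongrightarrow> measure_pmf.expectation \<nu> f"
proof -
  let ?E = measure_pmf.expectation
  have conv: "\<exists>l. (\<lambda>n. ?E (\<mu> n) f) \<longlonglongrightarrow> l" if f: "\<And>x. 0 \<le> f x" "\<And>x. f x \<le> 1" for f :: "'a \<Rightarrow> real"
  proof -
    have "Cauchy (\<lambda>n. ?E (\<mu> n) f)"
    proof (rule CauchyI')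
      fix e :: real assume "0 < e"
      then obtain N where N: "b N < e / 2"
        using order_tendstoD(2)[OF b, of "e / 2"] by (auto simp: eventually_sequentially)
      have near: "\<bar>?E (\<mu> N) f - ?E (\<mu> m) f\<bar> \<le> b N" if "N \<le> m" for m
        using cauchy[OF that] f unfolding tv_close_def by blast
      have "\<bar>?E (\<mu> m) f - ?E (\<mu> n) f\<bar> < e" if "N \<le> m" "m < n" for m n
        using near[of m] near[of n] N that by linarith
      then show "\<exists>M. \<forall>m\<ge>M. \<forall>n>m. dist (?E (\<mu> m) f) (?E (\<mu> n) f) < e"
        unfolding dist_real_def by blast
    qed
    then show ?thesis using Cauchy_convergent convergent_def by blast
  qed
  have "\<exists>l. (\<lambda>n. pmf (\<mu> n) y) \<longlonglongrightarrow> l" for y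
    using conv[of "indicator {y}"] by (simp add: measure_pmf_single)
  then obtain l where l: "\<And>y. (\<lambda>n. pmf (\<mu> n) y) \<longlonglongrightarrow> l y" by metis
  have l_nonneg: "0 \<le> l y" for y
    by (rule LIMSEQ_le_const[OF l]) auto
  have fatou: "(\<integral>\<^sup>+y. ennreal (l y) * ennreal (f y) \<partial>count_space UNIV) \<le> ennreal a"
    if f: "\<And>x. 0 \<le> f x" "\<And>x. f x \<le> 1" and a: "(\<lambda>n. ?E (\<mu> n) f) \<longlonglongrightarrow> a" for f :: "'a \<Rightarrow> real" and a
  proof -
    have "(\<lambda>n. ennreal (pmf (\<mu> n) y) * ennreal (f y)) \<longlonglongrightarrow> ennreal (l y) * ennreal (f y)" for y
      using f by (simp flip: ennreal_mult add: l_nonneg)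
        (intro tendsto_ennrealI tendsto_intros l)
    then have "(\<integral>\<^sup>+y. ennreal (l y) * ennreal (f y) \<partial>count_space UNIV) =
        (\<integral>\<^sup>+y. liminf (\<lambda>n. ennreal (pmf (\<mu> n) y) * ennreal (f y)) \<partial>count_space UNIV)"
      by (intro nn_integral_cong lim_imp_Liminf[symmetric]) auto
    also have "\<dots> \<le> liminf (\<lambda>n. \<integral>\<^sup>+y. ennreal (pmf (\<mu> n) y) * ennreal (f y) \<partial>count_space UNIV)"
      by (rule nn_integral_liminf) auto
    also have "(\<lambda>n. \<integral>\<^sup>+y. ennreal (pmf (\<mu> n) y) * ennreal (f y) \<partial>count_space UNIV) = (\<lambda>n. ennreal (?E (\<mu> n) f))"
      unfolding nn_integral_measure_pmf[symmetric] using f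
      by (intro ext nn_integral_eq_integral integrable_pmf_bounded[where B = 1]) auto
    also have "liminf \<dots> = ennreal a"
      using a by (intro lim_imp_Liminf tendsto_ennrealI) auto
    finally show ?thesis .
  qed
  have mass: "(\<integral>\<^sup>+y. ennreal (l y) \<partial>count_space UNIV) = 1"
  proof (rule antisym)
    show "(\<integral>\<^sup>+y. ennreal (l y) \<partial>count_space UNIV) \<le> 1"
      using fatou[of "\<lambda>_. 1" 1] by simp
    show "1 \<le> (\<integral>\<^sup>+y. ennreal (l y) \<partial>count_space UNIV)"
    proof (rule ennreal_le_epsilon)
      fix e :: real assume e: "0 < e"
      then obtain n where n: "b n < e / 2"
        using order_tendstoD(2)[OF b, of "e / 2"] by (auto simp: eventually_sequentially)
      obtain F where F: "finite F" "1 - e / 2 < measure_pmf.prob (\<mu> n) F"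
        using finite_set_carrying_pmf[of "e / 2" "\<mu> n"] e by auto
      have "1 - e \<le> (\<Sum>y\<in>F. pmf (\<mu> m) y)" if "n \<le> m" for m
      proof -
        have "\<bar>measure_pmf.prob (\<mu> n) F - measure_pmf.prob (\<mu> m) F\<bar> \<le> b n"
          by (rule tv_close_prob[OF cauchy[OF that]])
        then show ?thesis
          using F n unfolding measure_measure_pmf_finite[OF F(1), symmetric] by linarith
      qed
      then have "1 - e \<le> (\<Sum>y\<in>F. l y)"
        by (intro LIMSEQ_le_const[OF tendsto_sum[OF l]]) auto
      then have "1 \<le> ennreal ((\<Sum>y\<in>F. l y) + e)"
        by (metis (no_types) add.commute diff_le_eq ennreal_1 ennreal_leI)
      also have "\<dots> = (\<Sum>y\<in>F. ennreal (l y)) + ennreal e"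
        using e by (simp add: l_nonneg sum_nonneg)
      also have "(\<Sum>y\<in>F. ennreal (l y)) = (\<integral>\<^sup>+y\<in>F. ennreal (l y) \<partial>count_space UNIV)"
        using F by (simp add: nn_integral_count_space_indicator[symmetric] nn_integral_count_space_finite)
      also have "\<dots> \<le> (\<integral>\<^sup>+y. ennreal (l y) \<partial>count_space UNIV)"
        by (intro nn_integral_mono) (auto simp: indicator_def)
      finally show "1 \<le> (\<integral>\<^sup>+y. ennreal (l y) \<partial>count_space UNIV) + ennreal e"
        by (simp add: add_right_mono)
    qed
  qed
  define \<nu> where "\<nu> = embed_pmf l"
  have \<nu>: "pmf \<nu> y = l y" for y
    unfolding \<nu>_def by (rule pmf_embed_pmf[OF l_nonneg mass])
  have upper: "?E \<nu> f \<le> a"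
    if f: "\<And>x. 0 \<le> f x" "\<And>x. f x \<le> 1" and a: "(\<lambda>n. ?E (\<mu> n) f) \<longlonglongrightarrow> a" for f :: "'a \<Rightarrow> real" and a
  proof -
    have "0 \<le> a"
      by (rule LIMSEQ_le_const[OF a]) (use f in \<open>auto intro!: integral_nonneg_AE\<close>)
    have "ennreal (?E \<nu> f) = (\<integral>\<^sup>+y. ennreal (f y) \<partial>measure_pmf \<nu>)"
      using f by (intro nn_integral_eq_integral[symmetric] integrable_pmf_bounded[where B = 1]) auto
    also have "\<dots> \<le> ennreal a"
      using fatou[of f a] f a by (simp add: nn_integral_measure_pmf \<nu>)
    finally show ?thesis using \<open>0 \<le> a\<close> by simp
  qed
  have unit: "(\<lambda>n. ?E (\<mu> n) f) \<longlonglongrightarrow> ?E \<nu> f" if f: "\<And>x. 0 \<le> f x" "\<And>x. f x \<le> 1" for f :: "'a \<Rightarrow> real"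
  proof -
    obtain a where a: "(\<lambda>n. ?E (\<mu> n) f) \<longlonglongrightarrow> a" using conv[of f] f by blast
    have int: "?E p (\<lambda>x. 1 - f x) = 1 - ?E p f" for p
      using f by (subst Bochner_Integration.integral_diff)
        (auto intro!: integrable_pmf_bounded[where B = 1])
    have "(\<lambda>n. ?E (\<mu> n) (\<lambda>x. 1 - f x)) \<longlonglongrightarrow> 1 - a"
      unfolding int by (intro tendsto_intros a)
    then have "1 - ?E \<nu> f \<le> 1 - a"
      using upper[of "\<lambda>x. 1 - f x" "1 - a"] f by (simp add: int)
    with upper[of f a] f a show ?thesis by simp
  qed
  show ?thesis
  proof (intro exI allI impI)
    fix f :: "'a \<Rightarrow> real" and B assume "\<forall>x. \<bar>f x\<bar> \<le> B"
    then have f: "\<bar>f x\<bar> \<le> B" for x by blast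
    have B: "0 \<le> B" using f[of undefined] by linarith
    define g where "g x = (f x + B) / (2 * B + 1)" for x
    have g: "0 \<le> g x" "g x \<le> 1" for x
      using f[of x] B by (auto simp: g_def divide_simps abs_le_iff)
    have "f = (\<lambda>x. (2 * B + 1) * g x - B)"
      using B by (auto simp: g_def fun_eq_iff)
    moreover have "?E p (\<lambda>x. (2 * B + 1) * g x - B) = (2 * B + 1) * ?E p g - B" for p
      using g by (subst Bochner_Integration.integral_diff)
        (auto intro!: integrable_pmf_bounded[where B = 1] integrable_mult_right)
    ultimately have "?E p f = (2 * B + 1) * ?E p g - B" for p by metis
    then show "(\<lambda>n. ?E (\<mu> n) f) \<longlonglongrightarrow> ?E \<nu> f"
      by (auto intro!: tendsto_intros unit g)
  qed
qed

section \<open>Quasi-limiting laws of absorbed semigroups\<close>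

text \<open>
  A Markov semigroup on \<open>L\<close> together with an absorbing state \<open>c\<close>. At each fixed time survival
  has positive probability, so that conditioning on it makes sense.
\<close>

locale absorbed_semigroup =
  fixes L :: "'a set" and c :: 'a and K :: "real \<Rightarrow> 'a \<Rightarrow> 'a pmf"
  assumes state_space: "\<And>x t. x \<in> L \<Longrightarrow> 0 \<le> t \<Longrightarrow> set_pmf (K t x) \<subseteq> insert c L"
    and semigroup: "\<And>x s t. x \<in> L \<Longrightarrow> 0 \<le> s \<Longrightarrow> 0 \<le> t \<Longrightarrow> K (s + t) x = bind_pmf (K s x) (K t)"
    and absorbing: "\<And>t. 0 \<le> t \<Longrightarrow> K t c = return_pmf c"
    and survival: "\<And>x t. x \<in> L \<Longrightarrow> 0 \<le> t \<Longrightarrow> pmf (K t x) c < 1"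
begin

abbreviation \<phi> :: "real \<Rightarrow> 'a pmf \<Rightarrow> 'a pmf" where
  "\<phi> t \<equiv> survivors (K t) c"

lemma set_pmf_\<phi>:
  assumes "set_pmf \<mu> \<subseteq> L" "0 \<le> t"
  shows "set_pmf (\<phi> t \<mu>) \<subseteq> L"
proof -
  have "set_pmf (bind_pmf \<mu> (K t)) \<inter> - {c} \<noteq> {}"
    using assms survival by (intro bind_pmf_survives) auto
  then show ?thesis
    using assms(1) state_space[OF _ assms(2)] by (auto simp: survivors_def dest!: subsetD)
qed

text \<open>
  Since \<open>c\<close> is absorbing, killing at the intermediate time \<open>s\<close> removes nothing that killing at
  time \<open>s + t\<close> would keep.
\<close>

lemma killed_add:
  assumes "x \<in> L" "0 \<le> s" "0 \<le> t" and f: "\<And>x. \<bar>f x\<bar> \<le> B"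
  shows "killed (K (s + t)) c f x = killed (K s) c (killed (K t) c f) x"
proof -
  have "0 \<le> B" using f[of undefined] by linarith
  have "killed (K (s + t)) c f x = measure_pmf.expectation (K s x) (killed (K t) c f)"
    unfolding killed_def semigroup[OF assms(1-3)]
    by (rule expectation_bind_pmf_bounded[where B = B])
       (use f \<open>0 \<le> B\<close> in \<open>auto simp: indicator_def\<close>)
  also have "killed (K t) c f = (\<lambda>y. indicator (- {c}) y * killed (K t) c f y)"
    using \<open>0 \<le> t\<close> by (auto simp: fun_eq_iff killed_def absorbing indicator_def)
  finally show ?thesis unfolding killed_def .
qed

text \<open>
  Conditioning on survival up to \<open>s\<close> and then for another \<open>t\<close> is conditioning on survival up to
  \<open>s + t\<close>: in the ratio the first normalisation cancels.
\<close>

lemma \<phi>_add: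
  assumes supp: "set_pmf \<mu> \<subseteq> L" and s: "0 \<le> s" and t: "0 \<le> t"
  shows "\<phi> t (\<phi> s \<mu>) = \<phi> (s + t) \<mu>"
proof (rule pmf_eqI)
  fix y
  let ?E = measure_pmf.expectation
  have step: "?E (\<phi> s \<mu>) (killed (K t) c f) * ?E \<mu> (killed (K s) c (\<lambda>_. 1)) =
      ?E \<mu> (killed (K (s + t)) c f)" if f: "\<And>x. \<bar>f x\<bar> \<le> 1" for f
  proof -
    have "?E (\<phi> s \<mu>) (killed (K t) c f) * ?E \<mu> (killed (K s) c (\<lambda>_. 1)) =
        ?E \<mu> (killed (K s) c (killed (K t) c f))"
      by (rule expectation_survivors[OF supp, where B = 1])
         (use f s survival in \<open>auto intro: killed_abs_le\<close>)
    also have "\<dots> = ?E \<mu> (killed (K (s + t)) c f)"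
      using supp by (intro expectation_pmf_cong killed_add[symmetric, OF _ s t f]) auto
    finally show ?thesis .
  qed
  define f where "f = (indicator {y} :: 'a \<Rightarrow> real)"
  have f: "\<bar>f x\<bar> \<le> 1" for x by (simp add: f_def indicator_def)
  let ?N = "?E \<mu> (killed (K s) c (\<lambda>_. 1))"
  have "?E (\<phi> t (\<phi> s \<mu>)) f * ?E (\<phi> s \<mu>) (killed (K t) c (\<lambda>_. 1)) = ?E (\<phi> s \<mu>) (killed (K t) c f)"
    by (rule expectation_survivors[OF set_pmf_\<phi>[OF supp s] _ f]) (use t survival in auto)
  then have "?E (\<phi> t (\<phi> s \<mu>)) f * (?E (\<phi> s \<mu>) (killed (K t) c (\<lambda>_. 1)) * ?N) =
      ?E (\<phi> s \<mu>) (killed (K t) c f) * ?N"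
    by (metis mult.assoc)
  then have "?E (\<phi> t (\<phi> s \<mu>)) f * ?E \<mu> (killed (K (s + t)) c (\<lambda>_. 1)) =
      ?E \<mu> (killed (K (s + t)) c f)"
    by (simp add: step f)
  also have "\<dots> = ?E (\<phi> (s + t) \<mu>) f * ?E \<mu> (killed (K (s + t)) c (\<lambda>_. 1))"
    by (rule expectation_survivors[OF supp _ f, symmetric]) (use s t survival in auto)
  finally have "?E (\<phi> t (\<phi> s \<mu>)) f = ?E (\<phi> (s + t) \<mu>) f"
    using expectation_killed_one_pos[OF supp, of "K (s + t)" c] s t survival by auto
  then show "pmf (\<phi> t (\<phi> s \<mu>)) y = pmf (\<phi> (s + t) \<mu>) y"
    by (simp add: f_def measure_pmf_single)
qed

lemma \<phi>_tendsto:
  assumes supp: "\<And>n. set_pmf (\<mu> n) \<subseteq> L" "set_pmf \<nu> \<subseteq> L" and t: "0 \<le> t"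
    and lim: "\<And>f B. (\<And>x. \<bar>f x :: real\<bar> \<le> B) \<Longrightarrow>
      (\<lambda>n. measure_pmf.expectation (\<mu> n) f) \<longlonglongrightarrow> measure_pmf.expectation \<nu> f"
  shows "(\<lambda>n. pmf (\<phi> t (\<mu> n)) y) \<longlonglongrightarrow> pmf (\<phi> t \<nu>) y"
proof -
  let ?E = measure_pmf.expectation
  define f where "f = (indicator {y} :: 'a \<Rightarrow> real)"
  have f: "\<bar>f x\<bar> \<le> 1" for x by (simp add: f_def indicator_def)
  have ratio: "pmf (\<phi> t p) y = ?E p (killed (K t) c f) / ?E p (killed (K t) c (\<lambda>_. 1))"
    if "set_pmf p \<subseteq> L" for p
    using expectation_survivors[where f = f, OF that _ f, of "K t" c]
      expectation_killed_one_pos[OF that, of "K t" c] survival t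
    by (simp add: f_def measure_pmf_single field_simps)
  have "(\<lambda>n. ?E (\<mu> n) (killed (K t) c f) / ?E (\<mu> n) (killed (K t) c (\<lambda>_. 1))) \<longlonglongrightarrow>
      ?E \<nu> (killed (K t) c f) / ?E \<nu> (killed (K t) c (\<lambda>_. 1))"
  proof (intro tendsto_divide lim[where B = 1] killed_abs_le f)
    show "?E \<nu> (killed (K t) c (\<lambda>_. 1)) \<noteq> 0"
      using expectation_killed_one_pos[OF supp(2), of "K t" c] survival t by auto
  qed auto
  then show ?thesis by (simp add: ratio supp)
qed

text \<open>
  Once one time \<open>h\<close> has a common minorant heavier than the largest killing probability, the
  conditioned evolution contracts over \<open>h\<close> by a factor \<open>\<rho> < 1\<close>. After \<open>n\<close> such steps any two starting
  laws are within \<open>\<rho> ^ n\<close>, and the law at a time \<open>t \<ge> n * h\<close> is itself \<open>n\<close> steps applied to some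
  starting law. So all trajectories together are Cauchy, and have a single limit, which is invariant
  because \<open>\<phi> t\<close> commutes with \<open>\<phi> (n * h)\<close> and is continuous.
\<close>

theorem quasi_limiting_law:
  assumes "L \<noteq> {}" and h: "0 < h"
    and F: "finite F" "c \<notin> F"
    and minor: "\<And>x z. x \<in> L \<Longrightarrow> z \<in> F \<Longrightarrow> \<beta> z \<le> pmf (K h x) z"
    and kill: "\<And>x. x \<in> L \<Longrightarrow> pmf (K h x) c \<le> \<epsilon>" and gap: "\<epsilon> < sum \<beta> F"
  shows "\<exists>\<nu>. set_pmf \<nu> \<subseteq> L \<and> (\<forall>t\<ge>0. \<phi> t \<nu> = \<nu>) \<and>
    (\<forall>\<mu> y. set_pmf \<mu> \<subseteq> L \<longrightarrow> ((\<lambda>t. pmf (\<phi> t \<mu>) y) \<longlongrightarrow> pmf \<nu> y) at_top)"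
proof -
  let ?E = measure_pmf.expectation
  obtain x0 where x0: "x0 \<in> L" using \<open>L \<noteq> {}\<close> by blast
  \<comment> \<open>The minorant has mass at most one, so \<open>\<epsilon> < 1\<close> and the factor below is nonnegative.\<close>
  have "sum \<beta> F \<le> measure_pmf.prob (K h x0) F"
    using F minor[OF x0] by (simp add: measure_measure_pmf_finite sum_mono)
  then have B1: "sum \<beta> F \<le> 1"
    using measure_pmf.prob_le_1[of "K h x0" F] by linarith
  define \<rho> where "\<rho> = (1 - sum \<beta> F) / (1 - \<epsilon>)"
  have \<rho>: "0 \<le> \<rho>" "\<rho> < 1"
    using B1 gap by (auto simp: \<rho>_def divide_simps)
  have iterate: "tv_close (\<phi> (n * h) \<mu>) (\<phi> (n * h) \<mu>') (\<rho> ^ n)"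
    if "set_pmf \<mu> \<subseteq> L" "set_pmf \<mu>' \<subseteq> L" for n :: nat and \<mu> \<mu>'
  proof (induction n)
    case 0
    then show ?case by (simp add: tv_close_1)
  next
    case (Suc n)
    have "\<phi> (Suc n * h) p = \<phi> h (\<phi> (n * h) p)" if "set_pmf p \<subseteq> L" for p
      using \<phi>_add[OF that, of "n * h" h] h by (simp add: algebra_simps)
    moreover have "tv_close (\<phi> h (\<phi> (n * h) \<mu>)) (\<phi> h (\<phi> (n * h) \<mu>')) (\<rho> * \<rho> ^ n)"
      unfolding \<rho>_def
    proof (rule survivors_contraction[OF F minor kill])
      show "set_pmf (\<phi> (n * h) \<mu>) \<subseteq> L" "set_pmf (\<phi> (n * h) \<mu>') \<subseteq> L"
        using h by (intro set_pmf_\<phi> that; simp)+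
      show "tv_close (\<phi> (n * h) \<mu>) (\<phi> (n * h) \<mu>') (((1 - sum \<beta> F) / (1 - \<epsilon>)) ^ n)"
        using Suc unfolding \<rho>_def .
    qed (use B1 gap in auto)
    ultimately show ?case using that by simp
  qed
  have close: "tv_close (\<phi> (n * h) \<mu>) (\<phi> t \<mu>') (\<rho> ^ n)"
    if "set_pmf \<mu> \<subseteq> L" "set_pmf \<mu>' \<subseteq> L" "n * h \<le> t" for n :: nat and \<mu> \<mu>' t
  proof -
    have "\<phi> t \<mu>' = \<phi> (n * h) (\<phi> (t - n * h) \<mu>')"
      using \<phi>_add[OF that(2), of "t - n * h" "n * h"] that(3) h by simp
    then show ?thesis
      using iterate[OF that(1) set_pmf_\<phi>[OF that(2)], of "t - n * h" n] that(3) by simp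
  qed
  have \<rho>_lim: "(\<lambda>n. \<rho> ^ n) \<longlonglongrightarrow> 0"
    using \<rho> by (intro LIMSEQ_power_zero) auto
  define \<mu>\<^sub>0 where "\<mu>\<^sub>0 = return_pmf x0"
  have \<mu>\<^sub>0: "set_pmf \<mu>\<^sub>0 \<subseteq> L" by (simp add: \<mu>\<^sub>0_def x0)
  define \<mu> where "\<mu> n = \<phi> (real n * h) \<mu>\<^sub>0" for n
  have supp_\<mu>: "set_pmf (\<mu> n) \<subseteq> L" for n
    unfolding \<mu>_def using h by (intro set_pmf_\<phi> \<mu>\<^sub>0) auto
  have "tv_close (\<mu> n) (\<mu> m) (\<rho> ^ n)" if "n \<le> m" for n m
    unfolding \<mu>_def using that h by (intro close \<mu>\<^sub>0) auto
  from tv_cauchy_pmf_limit[OF this \<rho>_lim] obtain \<nu> where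
    \<nu>: "\<And>f B. (\<And>x. \<bar>f x :: real\<bar> \<le> B) \<Longrightarrow> (\<lambda>n. ?E (\<mu> n) f) \<longlonglongrightarrow> ?E \<nu> f"
    by blast
  have pmf_lim: "(\<lambda>n. pmf (\<mu> n) y) \<longlonglongrightarrow> pmf \<nu> y" for y
    using \<nu>[of "indicator {y}" 1] by (simp add: measure_pmf_single indicator_def)
  have supp_\<nu>: "set_pmf \<nu> \<subseteq> L"
  proof
    fix y assume "y \<in> set_pmf \<nu>"
    moreover have "pmf \<nu> y = 0" if "y \<notin> L"
    proof -
      have "pmf (\<mu> n) y = 0" for n
        using supp_\<mu>[of n] that by (auto simp: pmf_eq_0_set_pmf)
      with pmf_lim[of y] show ?thesis
        by (simp add: LIMSEQ_const_iff)
    qed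
    ultimately show "y \<in> L" by (auto simp: set_pmf_iff)
  qed
  have yaglom: "((\<lambda>t. pmf (\<phi> t \<mu>') y) \<longlongrightarrow> pmf \<nu> y) at_top" if "set_pmf \<mu>' \<subseteq> L" for \<mu>' y
  proof (rule tendstoI)
    fix e :: real assume "0 < e"
    then have "\<forall>\<^sub>F n in sequentially. \<rho> ^ n < e / 2 \<and> dist (pmf (\<mu> n) y) (pmf \<nu> y) < e / 2"
      by (intro eventually_conj order_tendstoD(2)[OF \<rho>_lim] tendstoD[OF pmf_lim]) auto
    then obtain n where n: "\<rho> ^ n < e / 2" "dist (pmf (\<mu> n) y) (pmf \<nu> y) < e / 2"
      by (auto simp: eventually_sequentially)
    show "\<forall>\<^sub>F t in at_top. dist (pmf (\<phi> t \<mu>') y) (pmf \<nu> y) < e"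
    proof (rule eventually_at_top_linorderI)
      fix t assume "real n * h \<le> t"
      from close[OF \<mu>\<^sub>0 that this]
      have "\<bar>pmf (\<mu> n) y - pmf (\<phi> t \<mu>') y\<bar> \<le> \<rho> ^ n"
        unfolding \<mu>_def by (auto dest: tv_close_prob[where A = "{y}"] simp: measure_pmf_single)
      with n show "dist (pmf (\<phi> t \<mu>') y) (pmf \<nu> y) < e"
        unfolding dist_real_def by linarith
    qed
  qed
  have "\<phi> t \<nu> = \<nu>" if t: "0 \<le> t" for t
  proof (rule pmf_eqI)
    fix y
    have "\<phi> t (\<mu> n) = \<phi> (real n * h) (\<phi> t \<mu>\<^sub>0)" for n
      unfolding \<mu>_def using t h \<mu>\<^sub>0 by (simp add: \<phi>_add add.commute)
    then have "(\<lambda>n. pmf (\<phi> t (\<mu> n)) y) = (\<lambda>n. pmf (\<phi> (real n * h) (\<phi> t \<mu>\<^sub>0)) y)"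
      by simp
    also have "\<dots> \<longlonglongrightarrow> pmf \<nu> y"
      by (rule filterlim_compose[OF yaglom[OF set_pmf_\<phi>[OF \<mu>\<^sub>0 t]]
          filterlim_at_top_mult_tendsto_pos[OF tendsto_const h filterlim_real_sequentially]])
    finally have "(\<lambda>n. pmf (\<phi> t (\<mu> n)) y) \<longlonglongrightarrow> pmf \<nu> y" .
    moreover have "(\<lambda>n. pmf (\<phi> t (\<mu> n)) y) \<longlonglongrightarrow> pmf (\<phi> t \<nu>) y"
      by (rule \<phi>_tendsto[OF supp_\<mu> supp_\<nu> t], rule \<nu>)
    ultimately show "pmf (\<phi> t \<nu>) y = pmf \<nu> y"
      using LIMSEQ_unique by blast
  qed
  with supp_\<nu> yaglom show ?thesis by blast
qed

end

section \<open>Transition probabilities bounded by their rates\<close>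

text \<open>
  Splitting \<open>[0, t]\<close> into \<open>n\<close> equal parts gives \<open>r t \<ge> n * r (t / n)\<close>, and the right-hand side
  tends to \<open>t * d\<close>.
\<close>

lemma superadditive_ge_derivative:
  fixes r :: "real \<Rightarrow> real"
  assumes r0: "r 0 = 0" and super: "\<And>s t. 0 \<le> s \<Longrightarrow> 0 \<le> t \<Longrightarrow> r s + r t \<le> r (s + t)"
    and deriv: "(r has_real_derivative d) (at 0 within {0..})" and t: "0 \<le> t"
  shows "t * d \<le> r t"
proof (cases "t = 0")
  case False
  with t have t: "0 < t" by simp
  have mult: "real n * r s \<le> r (real n * s)" if "0 \<le> s" for n s
  proof (induction n)
    case 0
    then show ?case by (simp add: r0)
  next
    case (Suc n)
    have "real (Suc n) * r s \<le> r (real n * s) + r s"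
      using Suc by (simp add: algebra_simps)
    also have "\<dots> \<le> r (real n * s + s)"
      using that by (intro super) auto
    finally show ?case by (simp add: algebra_simps)
  qed
  have "((\<lambda>s. r s / s) \<longlongrightarrow> d) (at 0 within {0..})"
    using deriv by (simp add: has_field_derivative_iff r0)
  moreover have "filterlim (\<lambda>n. t / real (Suc n)) (at 0 within {0..}) sequentially"
    unfolding filterlim_at using t LIMSEQ_Suc[OF lim_const_over_n[of t]] by simp
  ultimately have "(\<lambda>n. r (t / real (Suc n)) / (t / real (Suc n))) \<longlonglongrightarrow> d"
    by (rule filterlim_compose)
  then have "(\<lambda>n. t * (r (t / real (Suc n)) / (t / real (Suc n)))) \<longlonglongrightarrow> t * d"
    by (intro tendsto_intros)
  then show ?thesis
  proof (rule LIMSEQ_le_const2, intro exI allI impI)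
    fix n
    have "t * (r (t / real (Suc n)) / (t / real (Suc n))) = real (Suc n) * r (t / real (Suc n))"
      using t by (simp add: field_simps)
    also have "\<dots> \<le> r t"
      using mult[of "t / real (Suc n)" "Suc n"] t by simp
    finally show "t * (r (t / real (Suc n)) / (t / real (Suc n))) \<le> r t" .
  qed
qed (simp add: r0)

text \<open>
  Entrywise differentiability at time zero carries no uniformity in the starting state. Every
  estimate below therefore comes from keeping a few intermediate states in the semigroup equation,
  and is uniform in the starting state as soon as the diagonal rates are bounded.
\<close>

locale differentiable_semigroup =
  fixes E :: "'a set" and K :: "real \<Rightarrow> 'a \<Rightarrow> 'a pmf" and q :: "'a \<Rightarrow> 'a \<Rightarrow> real"
  assumes K_add: "\<And>x s t. x \<in> E \<Longrightarrow> 0 \<le> s \<Longrightarrow> 0 \<le> t \<Longrightarrow> K (s + t) x = bind_pmf (K s x) (K t)"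
    and K_0: "\<And>x. x \<in> E \<Longrightarrow> K 0 x = return_pmf x"
    and K_deriv: "\<And>x y. x \<in> E \<Longrightarrow> y \<in> E \<Longrightarrow>
      ((\<lambda>t. pmf (K t x) y) has_real_derivative q x y) (at 0 within {0..})"
begin

lemma sum_paths_le:
  assumes "x \<in> E" "0 \<le> s" "0 \<le> t" "finite A"
  shows "(\<Sum>z\<in>A. pmf (K s x) z * pmf (K t z) y) \<le> pmf (K (s + t) x) y"
  unfolding K_add[OF assms(1-3)] pmf_bind
  by (rule sum_le_expectation_pmf[where B = 1]) (use assms in \<open>auto simp: pmf_le_1\<close>)

lemma rate_nonneg:
  assumes "x \<in> E" "y \<in> E" "x \<noteq> y"
  shows "0 \<le> q x y"
proof -
  have "((\<lambda>t. pmf (K t x) y / t) \<longlongrightarrow> q x y) (at 0 within {0..})"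
    using K_deriv[OF assms(1,2)] assms by (simp add: has_field_derivative_iff K_0)
  moreover have "\<forall>\<^sub>F t in at 0 within {0..}. 0 \<le> pmf (K t x) y / t"
    by (auto simp: eventually_at_filter)
  moreover have "at (0::real) within {0..} \<noteq> bot"
    by (simp add: at_within_Ici_at_right)
  ultimately show ?thesis by (rule tendsto_lowerbound)
qed

lemma diag_supermult:
  assumes "x \<in> E" "0 \<le> s" "0 \<le> t"
  shows "pmf (K s x) x * pmf (K t x) x \<le> pmf (K (s + t) x) x"
  using sum_paths_le[OF assms, of "{x}" x] by simp

text \<open>
  The probability of being in \<open>x\<close> is positive for small times by continuity, hence for all times by
  dividing \<open>[0, t]\<close> into short pieces and being in \<open>x\<close> at each of their ends.
\<close>

lemma diag_pos:
  assumes x: "x \<in> E" and t: "0 \<le> t"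
  shows "0 < pmf (K t x) x"
proof -
  have "((\<lambda>t. pmf (K t x) x) \<longlongrightarrow> pmf (K 0 x) x) (at 0 within {0..})"
    using DERIV_continuous[OF K_deriv[OF x x]] by (simp add: continuous_within)
  then have "\<forall>\<^sub>F t in at_right 0. 0 < pmf (K t x) x"
    unfolding at_within_Ici_at_right by (rule order_tendstoD(1)) (simp add: K_0 x)
  then obtain u where u: "0 < u" "\<And>s. 0 < s \<Longrightarrow> s < u \<Longrightarrow> 0 < pmf (K s x) x"
    unfolding eventually_at_right_field by auto
  have u': "0 < pmf (K s x) x" if "0 \<le> s" "s < u" for s
    using u(2)[of s] that by (cases "s = 0") (auto simp: K_0 x)
  obtain n where n: "t < real n * u"
    using reals_Archimedean3[OF u(1)] by blast
  then have "0 < real n"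
    using t by (cases n) auto
  then have s: "0 \<le> t / real n" "t / real n < u"
    using n t by (auto simp: field_simps)
  have "0 < pmf (K (real m * (t / real n)) x) x" for m
  proof (induction m)
    case 0
    then show ?case by (simp add: K_0 x)
  next
    case (Suc m)
    have "0 < pmf (K (real m * (t / real n)) x) x * pmf (K (t / real n) x) x"
      using Suc u'[OF s] by simp
    also have "\<dots> \<le> pmf (K (real m * (t / real n) + t / real n) x) x"
      using s(1) by (intro diag_supermult x mult_nonneg_nonneg) auto
    also have "real m * (t / real n) + t / real n = real (Suc m) * (t / real n)"
      by (simp add: ring_distribs add_divide_distrib)
    finally show ?case .
  qed
  from this[of n] show ?thesis using \<open>0 < real n\<close> by simp
qed

text \<open>
  The logarithm of the diagonal entry is superadditive with derivative \<open>q x x\<close> at zero.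
\<close>

lemma diag_ge_exp:
  assumes x: "x \<in> E" and t: "0 \<le> t"
  shows "exp (t * q x x) \<le> pmf (K t x) x"
proof -
  have "t * q x x \<le> ln (pmf (K t x) x)"
  proof (rule superadditive_ge_derivative[OF _ _ _ t])
    show "ln (pmf (K 0 x) x) = 0" by (simp add: K_0 x)
    show "ln (pmf (K s x) x) + ln (pmf (K t x) x) \<le> ln (pmf (K (s + t) x) x)"
      if "0 \<le> s" "0 \<le> t" for s t
      using diag_supermult[OF x that] diag_pos[OF x that(1)] diag_pos[OF x that(2)]
        diag_pos[OF x, of "s + t"] that
      by (simp flip: ln_mult_pos)
    have "((\<lambda>t. ln (pmf (K t x) x)) has_real_derivative 1 / pmf (K 0 x) x * q x x) (at 0 within {0..})"
      by (rule DERIV_chain2[OF DERIV_ln_divide[OF diag_pos[OF x order_refl]] K_deriv[OF x x]])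
    then show "((\<lambda>t. ln (pmf (K t x) x)) has_real_derivative q x x) (at 0 within {0..})"
      by (simp add: K_0 x)
  qed
  then show ?thesis
    using diag_pos[OF x t] by (metis exp_le_cancel_iff exp_ln)
qed

text \<open>
  Observing the intermediate time only in \<open>x\<close> or in \<open>z\<close> shows that \<open>exp (b * t) * pmf (K t x) z\<close> is
  superadditive in \<open>t\<close>: by the bound on the diagonal, the factor \<open>exp (b * s)\<close> pays for having stayed
  put during a piece of length \<open>s\<close>.
\<close>

lemma off_diag_ge:
  assumes xz: "x \<in> E" "z \<in> E" "x \<noteq> z" and b: "- q x x \<le> b" "- q z z \<le> b" and t: "0 \<le> t"
  shows "t * exp (- (b * t)) * q x z \<le> pmf (K t x) z"
proof -
  have diag: "exp (- (b * s)) \<le> pmf (K s y) y" if "y \<in> {x, z}" "0 \<le> s" for s y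
  proof -
    have "- (b * s) \<le> s * q y y"
      using that b mult_left_mono[of "- q y y" b s] by (auto simp: algebra_simps)
    also have "exp \<dots> \<le> pmf (K s y) y"
      using that xz by (intro diag_ge_exp) auto
    finally show ?thesis by simp
  qed
  have "t * q x z \<le> exp (b * t) * pmf (K t x) z"
  proof (rule superadditive_ge_derivative[OF _ _ _ t])
    show "exp (b * 0) * pmf (K 0 x) z = 0" using xz by (simp add: K_0)
    show "exp (b * s) * pmf (K s x) z + exp (b * t) * pmf (K t x) z \<le>
        exp (b * (s + t)) * pmf (K (s + t) x) z" if st: "0 \<le> s" "0 \<le> t" for s t
    proof -
      have "exp (b * s) * pmf (K s x) z + exp (b * t) * pmf (K t x) z =
          exp (b * (s + t)) * (exp (- (b * s)) * pmf (K t x) z + pmf (K s x) z * exp (- (b * t)))"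
        by (simp add: exp_minus exp_add ring_distribs field_simps)
      also have "\<dots> \<le> exp (b * (s + t)) * (pmf (K s x) x * pmf (K t x) z + pmf (K s x) z * pmf (K t z) z)"
        using st by (intro mult_left_mono add_mono mult_right_mono diag) auto
      also have "\<dots> \<le> exp (b * (s + t)) * pmf (K (s + t) x) z"
        using sum_paths_le[OF xz(1) st, of "{x, z}" z] xz(3) by (intro mult_left_mono) auto
      finally show ?thesis .
    qed
    show "((\<lambda>t. exp (b * t) * pmf (K t x) z) has_real_derivative q x z) (at 0 within {0..})"
      using xz by (auto intro!: derivative_eq_intros K_deriv simp: K_0)
  qed
  then have "exp (- (b * t)) * (t * q x z) \<le> exp (- (b * t)) * (exp (b * t) * pmf (K t x) z)"
    by (intro mult_left_mono) auto
  then show ?thesis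
    by (simp add: exp_minus field_simps)
qed

text \<open>
  A differentiable entry need not be bounded above by its tangent uniformly in the starting state.
  The upper bound is obtained from the lower bounds for all other entries of the row, whose total is
  one: what these leave to \<open>c\<close> is \<open>h * q x c\<close> up to a term of second order, because the row of
  rates sums to zero.
\<close>

lemma hitting_prob_le:
  assumes x: "x \<in> E" and c: "c \<in> E" and "x \<noteq> c" and b: "\<And>y. y \<in> E \<Longrightarrow> - q y y \<le> b"
    and summable: "q x summable_on (E - {x})" and row: "q x x = - (\<Sum>\<^sub>\<infinity>y\<in>E - {x}. q x y)"
    and h: "0 < h"
  shows "pmf (K h x) c \<le> h * q x c + h\<^sup>2 * b\<^sup>2"
proof -
  define S where "S = - q x x"
  define R where "R = (\<Sum>\<^sub>\<infinity>y\<in>E - {x, c}. q x y)"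
  have summable_R: "q x summable_on (E - {x, c})"
    by (rule summable_on_subset_banach[OF summable]) auto
  have "E - {x} = insert c (E - {x, c})" using c \<open>x \<noteq> c\<close> by auto
  then have S: "S = q x c + R"
    unfolding S_def R_def row using summable_R by (simp add: infsum_insert)
  have R: "0 \<le> R"
    unfolding R_def using x by (intro infsum_nonneg rate_nonneg) auto
  have "0 \<le> q x c" using x c \<open>x \<noteq> c\<close> by (rule rate_nonneg)
  have "S \<le> b" using b[OF x] by (simp add: S_def)
  have "R \<le> (h * S - pmf (K h x) c) / (h * exp (- (b * h)))"
    unfolding R_def
  proof (rule infsum_le_finite_sums[OF summable_R])
    fix F assume F: "finite F" "F \<subseteq> E - {x, c}"
    have "h * exp (- (b * h)) * sum (q x) F \<le> (\<Sum>y\<in>F. pmf (K h x) y)"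
      unfolding sum_distrib_left using F x h b by (intro sum_mono off_diag_ge) auto
    moreover have "1 - h * S \<le> pmf (K h x) x"
      using order_trans[OF exp_ge_add_one_self[of "h * q x x"] diag_ge_exp[OF x, of h]] h
      by (simp add: S_def)
    moreover have "(\<Sum>y\<in>insert x (insert c F). pmf (K h x) y) \<le> 1"
      using measure_pmf.prob_le_1[of "K h x" "insert x (insert c F)"] F
      by (simp only: measure_measure_pmf_finite finite_insert)
    moreover have "(\<Sum>y\<in>insert x (insert c F). pmf (K h x) y) =
        pmf (K h x) x + pmf (K h x) c + (\<Sum>y\<in>F. pmf (K h x) y)"
      using F \<open>x \<noteq> c\<close> by (subst sum.insert, auto)+
    ultimately have "h * exp (- (b * h)) * sum (q x) F \<le> h * S - pmf (K h x) c"
      by linarith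
    then show "sum (q x) F \<le> (h * S - pmf (K h x) c) / (h * exp (- (b * h)))"
      using h by (simp add: pos_le_divide_eq mult.commute)
  qed
  then have "h * exp (- (b * h)) * R \<le> h * S - pmf (K h x) c"
    using h by (simp add: pos_le_divide_eq mult.commute)
  moreover have "h * (1 - b * h) * R \<le> h * exp (- (b * h)) * R"
    using h R exp_ge_add_one_self[of "- (b * h)"] by (intro mult_right_mono mult_left_mono) auto
  ultimately have "pmf (K h x) c \<le> h * S - h * (1 - b * h) * R" by linarith
  also have "\<dots> = h * q x c + h\<^sup>2 * (b * R)"
    by (simp add: S algebra_simps power2_eq_square)
  also have "\<dots> \<le> h * q x c + h\<^sup>2 * b\<^sup>2"
    using S \<open>S \<le> b\<close> \<open>0 \<le> q x c\<close> R
    by (simp add: power2_eq_square mult_left_mono)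
  finally show ?thesis .
qed

end

section \<open>The semigroup of a Markov process\<close>

text \<open>
  The law of a random variable with countably many values, as a \<open>pmf\<close>. On other random variables
  the value is arbitrary.
\<close>

definition law_of :: "'w measure \<Rightarrow> ('w \<Rightarrow> 'b) \<Rightarrow> 'b pmf" where
  "law_of M X = Abs_pmf (distr M (count_space UNIV) X)"

lemma measurable_count_space_UNIV:
  assumes "X \<in> measurable M (count_space E)"
  shows "X \<in> measurable M (count_space UNIV)"
proof -
  have "X -` A \<inter> space M = X -` (A \<inter> E) \<inter> space M" for A
    using measurable_space[OF assms] by auto
  moreover have "X -` (A \<inter> E) \<inter> space M \<in> sets M" for A
    by (rule measurable_sets[OF assms]) auto
  ultimately show ?thesis by (auto simp: measurable_def)
qed

lemma measure_pmf_law_of: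
  assumes M: "prob_space M" and X: "X \<in> measurable M (count_space E)" and E: "countable E"
  shows "measure_pmf (law_of M X) = distr M (count_space UNIV) X"
proof -
  interpret prob_space M by fact
  note X' = measurable_count_space_UNIV[OF X]
  interpret D: prob_space "distr M (count_space UNIV) X"
    by (rule prob_space_distr[OF X'])
  have "AE x in distr M (count_space UNIV) X. x \<in> E"
    using measurable_space[OF X] by (subst AE_distr_iff[OF X']) auto
  then have "AE x in distr M (count_space UNIV) X. measure (distr M (count_space UNIV) X) {x} \<noteq> 0"
    using E by (subst D.AE_support_countable) auto
  then show ?thesis
    unfolding law_of_def using D.prob_space_axioms by (intro Abs_pmf_inverse) auto
qed

lemma pmf_law_of:
  assumes "prob_space M" "X \<in> measurable M (count_space E)" "countable E"
  shows "pmf (law_of M X) y = \<P>(\<omega> in M. X \<omega> = y)"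
  unfolding pmf.rep_eq measure_pmf_law_of[OF assms]
  by (subst measure_distr[OF measurable_count_space_UNIV[OF assms(2)]])
     (auto intro!: arg_cong[where f = "measure M"])

lemma set_pmf_law_of:
  assumes "prob_space M" and X: "X \<in> measurable M (count_space E)" and "countable E"
  shows "set_pmf (law_of M X) \<subseteq> E"
proof
  fix y assume y: "y \<in> set_pmf (law_of M X)"
  then have "{\<omega> \<in> space M. X \<omega> = y} \<noteq> {}"
    unfolding set_pmf_iff pmf_law_of[OF assms] by (metis measure_empty)
  then show "y \<in> E" using measurable_space[OF X] by auto
qed

lemma map_pmf_law_of:
  assumes M: "prob_space M" and X: "X \<in> measurable M (count_space E)" "countable E"
    and gX: "(\<lambda>\<omega>. g (X \<omega>)) \<in> measurable M (count_space E')" "countable E'"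
  shows "map_pmf g (law_of M X) = law_of M (\<lambda>\<omega>. g (X \<omega>))"
  by (rule measure_pmf_inject[THEN iffD1])
     (simp add: map_pmf_rep_eq measure_pmf_law_of[OF M X] measure_pmf_law_of[OF M gX]
        distr_distr measurable_count_space_UNIV[OF X(1)] o_def)

definition transition_law ::
    "('a \<Rightarrow> 'w measure) \<Rightarrow> (real \<Rightarrow> 'w \<Rightarrow> 'a) \<Rightarrow> real \<Rightarrow> 'a \<Rightarrow> 'a pmf" where
  "transition_law Pr Z t x = law_of (Pr x) (Z t)"

context
  fixes E :: "'a set" and Pr :: "'a \<Rightarrow> 'w measure" and Z :: "real \<Rightarrow> 'w \<Rightarrow> 'a"
  assumes E: "countable E" and process: "regular_jump_markov_process E Pr Z"
begin

lemma process_prob_space: "x \<in> E \<Longrightarrow> prob_space (Pr x)"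
  using process by (simp add: regular_jump_markov_process_def)

lemma process_measurable: "x \<in> E \<Longrightarrow> 0 \<le> t \<Longrightarrow> Z t \<in> measurable (Pr x) (count_space E)"
  using process by (simp add: regular_jump_markov_process_def)

lemma pmf_transition_law:
  "x \<in> E \<Longrightarrow> 0 \<le> t \<Longrightarrow> pmf (transition_law Pr Z t x) y = trans_prob Pr Z t x y"
  unfolding transition_law_def trans_prob_def
  by (rule pmf_law_of[OF process_prob_space process_measurable E])

lemma set_transition_law: "x \<in> E \<Longrightarrow> 0 \<le> t \<Longrightarrow> set_pmf (transition_law Pr Z t x) \<subseteq> E"
  unfolding transition_law_def
  by (rule set_pmf_law_of[OF process_prob_space process_measurable E])

lemma transition_law_0:
  assumes x: "x \<in> E"
  shows "transition_law Pr Z 0 x = return_pmf x"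
proof -
  interpret prob_space "Pr x" by (rule process_prob_space[OF x])
  have "AE \<omega> in Pr x. Z 0 \<omega> = x"
    using process x by (simp add: regular_jump_markov_process_def)
  moreover have "{\<omega> \<in> space (Pr x). Z 0 \<omega> = x} \<in> events"
    using measurable_sets[OF process_measurable[OF x order_refl], of "{x}"] x
    by (simp add: vimage_def Collect_conj_eq Int_commute)
  ultimately have "trans_prob Pr Z 0 x x = 1"
    unfolding trans_prob_def by (subst prob_Collect_eq_1) auto
  then have "pmf (transition_law Pr Z 0 x) x = 1"
    using x by (simp add: pmf_transition_law)
  then have "set_pmf (transition_law Pr Z 0 x) \<subseteq> {x}"
    using measure_pmf.prob_eq_1[of "{x}" "transition_law Pr Z 0 x"]
    by (auto simp: measure_pmf_single AE_measure_pmf_iff)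
  then show ?thesis by (simp add: set_pmf_subset_singleton)
qed

lemma joint_prob:
  assumes x: "x \<in> E" and s: "0 \<le> s" and t: "0 \<le> t" and zy: "z \<in> E" "y \<in> E"
  shows "\<P>(\<omega> in Pr x. Z s \<omega> = z \<and> Z (s + t) \<omega> = y) = trans_prob Pr Z s x z * trans_prob Pr Z t z y"
proof -
  interpret prob_space "Pr x" by (rule process_prob_space[OF x])
  have ev: "{\<omega> \<in> space (Pr x). Z s \<omega> = z} \<in> events"
    using measurable_sets[OF process_measurable[OF x s], of "{z}"] zy
    by (simp add: vimage_def Collect_conj_eq Int_commute)
  show ?thesis
  proof (cases "trans_prob Pr Z s x z = 0")
    case True
    have "\<P>(\<omega> in Pr x. Z s \<omega> = z \<and> Z (s + t) \<omega> = y) \<le> \<P>(\<omega> in Pr x. Z s \<omega> = z)"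
      by (rule finite_measure_mono[OF _ ev]) auto
    with True show ?thesis
      by (simp add: trans_prob_def measure_le_0_iff)
  next
    case False
    then have pos: "0 < \<P>(\<omega> in Pr x. Z s \<omega> = z)"
      by (simp add: trans_prob_def zero_less_measure_iff)
    have "\<forall>F a. \<forall>y\<in>E. finite F \<and> F \<subseteq> {0..s} \<and> s \<in> F \<and> \<P>(\<omega> in Pr x. \<forall>u\<in>F. Z u \<omega> = a u) > 0 \<longrightarrow>
        \<P>(\<omega> in Pr x. Z (s + t) \<omega> = y \<bar> \<forall>u\<in>F. Z u \<omega> = a u) = trans_prob Pr Z t (a s) y"
      using process x s t unfolding regular_jump_markov_process_def by blast
    \<comment> \<open>The present alone is observed, so the set of observation times is the singleton of \<open>s\<close>.\<close>
    from this[rule_format, of y "{s}" "\<lambda>_. z"] pos s zy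
    have "\<P>(\<omega> in Pr x. Z (s + t) \<omega> = y \<bar> Z s \<omega> = z) = trans_prob Pr Z t z y"
      by simp
    with pos show ?thesis
      unfolding cond_prob_def by (simp add: trans_prob_def field_simps conj_commute)
  qed
qed

text \<open>
  The Chapman--Kolmogorov equation is the second marginal of the joint law at the two times; the
  Markov property identifies that joint law as a composition of kernels.
\<close>

lemma transition_law_add:
  assumes x: "x \<in> E" and s: "0 \<le> s" and t: "0 \<le> t"
  shows "transition_law Pr Z (s + t) x = bind_pmf (transition_law Pr Z s x) (transition_law Pr Z t)"
proof -
  interpret prob_space "Pr x" by (rule process_prob_space[OF x])
  let ?K = "transition_law Pr Z"
  define XY where "XY \<omega> = (Z s \<omega>, Z (s + t) \<omega>)" for \<omega>
  have Xs: "Z s \<in> measurable (Pr x) (count_space E)" "Z (s + t) \<in> measurable (Pr x) (count_space E)"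
    using x s t by (auto intro!: process_measurable)
  have XY: "XY \<in> measurable (Pr x) (count_space (E \<times> E))"
  proof (subst measurable_count_space_eq_countable, safe)
    show "countable (E \<times> E)" using E by simp
  next
    fix \<omega> assume "\<omega> \<in> space (Pr x)"
    then show "XY \<omega> \<in> E \<times> E"
      using Xs[THEN measurable_space] by (auto simp: XY_def)
  next
    fix z y assume "z \<in> E" "y \<in> E"
    then have "(Z s -` {z} \<inter> space (Pr x)) \<inter> (Z (s + t) -` {y} \<inter> space (Pr x)) \<in> events"
      using sets.Int[OF measurable_sets[OF Xs(1), of "{z}"] measurable_sets[OF Xs(2), of "{y}"]]
      by simp
    also have "(Z s -` {z} \<inter> space (Pr x)) \<inter> (Z (s + t) -` {y} \<inter> space (Pr x)) =
        XY -` {(z, y)} \<inter> space (Pr x)"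
      by (auto simp: XY_def)
    finally show "XY -` {(z, y)} \<inter> space (Pr x) \<in> events" .
  qed
  have EE: "countable (E \<times> E)" using E by simp
  note J = prob_space_axioms XY EE
  have joint: "law_of (Pr x) XY = bind_pmf (?K s x) (\<lambda>z. map_pmf (Pair z) (?K t z))"
  proof (rule pmf_eqI)
    fix zy :: "'a \<times> 'a"
    obtain z y where zy: "zy = (z, y)" by fastforce
    have "pmf (bind_pmf (?K s x) (\<lambda>z. map_pmf (Pair z) (?K t z))) (z, y) =
        measure_pmf.expectation (?K s x) (\<lambda>z'. indicator {z} z' * pmf (?K t z) y)"
      unfolding pmf_bind
    proof (intro expectation_pmf_cong)
      fix z'
      show "pmf (map_pmf (Pair z') (?K t z')) (z, y) = indicator {z} z' * pmf (?K t z) y"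
      proof (cases "z' = z")
        case True
        then show ?thesis using pmf_map_inj'[of "Pair z" "?K t z" y] by (simp add: inj_on_def)
      next
        case False
        then show ?thesis by (auto intro!: pmf_map_outside)
      qed
    qed
    also have "\<dots> = pmf (?K s x) z * pmf (?K t z) y"
      by (simp add: measure_pmf_single)
    also have "\<dots> = pmf (law_of (Pr x) XY) (z, y)"
    proof (cases "z \<in> E \<and> y \<in> E")
      case True
      then show ?thesis
        using joint_prob[OF x s t, of z y] x s t
        by (simp add: pmf_law_of[OF J] XY_def pmf_transition_law)
    next
      case False
      have "pmf (law_of (Pr x) XY) (z, y) = 0"
        using set_pmf_law_of[OF J] False by (auto simp: pmf_eq_0_set_pmf)
      moreover have "pmf (?K s x) z * pmf (?K t z) y = 0"
        using set_transition_law[OF x s] set_transition_law[OF _ t, of z] False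
        by (auto simp: pmf_eq_0_set_pmf)
      ultimately show ?thesis by simp
    qed
    finally show "pmf (law_of (Pr x) XY) zy =
        pmf (bind_pmf (?K s x) (\<lambda>z. map_pmf (Pair z) (?K t z))) zy"
      by (simp add: zy)
  qed
  have "?K (s + t) x = map_pmf snd (law_of (Pr x) XY)"
    unfolding transition_law_def
    by (subst map_pmf_law_of[OF J, of snd E]) (use Xs E in \<open>auto simp: XY_def\<close>)
  also have "\<dots> = bind_pmf (?K s x) (?K t)"
    unfolding joint by (simp add: map_bind_pmf map_pmf_comp)
  finally show ?thesis .
qed

end

section \<open>Existence, uniqueness and attraction\<close>

text \<open>
  The definition of \<^const>\<open>conditioned_law\<close> normalises by the mass that is not in \<open>c\<close>, which is the
  conditioning in \<^const>\<open>survivors\<close>.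
\<close>

lemma conditioned_law_eq:
  assumes supp: "set_pmf \<mu> \<subseteq> L" and x: "x \<in> L" and c: "c \<notin> L"
    and P: "\<And>y z. y \<in> L \<Longrightarrow> P t y z = pmf (K t y) z"
    and surv: "\<And>y. y \<in> L \<Longrightarrow> pmf (K t y) c < 1"
  shows "conditioned_law L c P \<mu> t x = pmf (survivors (K t) c \<mu>) x"
proof -
  have sum_eq: "(\<Sum>\<^sub>\<infinity>y\<in>L. pmf \<mu> y * P t y z) = pmf (bind_pmf \<mu> (K t)) z" for z
  proof -
    have "(\<Sum>\<^sub>\<infinity>y\<in>L. pmf \<mu> y * P t y z) = (\<Sum>\<^sub>\<infinity>y\<in>L. pmf \<mu> y * pmf (K t y) z)"
      by (rule infsum_cong) (simp add: P)
    also have "\<dots> = pmf (bind_pmf \<mu> (K t)) z"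
      unfolding pmf_bind by (rule expectation_pmf_infsum[OF supp, where B = 1, symmetric]) (simp add: pmf_le_1)
    finally show ?thesis .
  qed
  have "measure_pmf.prob (bind_pmf \<mu> (K t)) (- {c}) = 1 - pmf (bind_pmf \<mu> (K t)) c"
    using measure_pmf.prob_compl[of "{c}" "bind_pmf \<mu> (K t)"]
    by (simp add: Compl_eq_Diff_UNIV measure_pmf_single)
  moreover have "x \<noteq> c" using x c by auto
  ultimately show ?thesis
    unfolding conditioned_law_def survivors_def sum_eq
    using pmf_cond[OF bind_pmf_survives[where k = "K t", OF supp surv]] by simp
qed

text \<open>
  Passage of the finite exit rate from extended nonnegative reals to real sums.
\<close>

lemma summable_rates:
  assumes "max_exit_rate L c q < \<infinity>"
    and nonneg: "\<And>x y. x \<in> L \<Longrightarrow> y \<in> insert c L \<Longrightarrow> x \<noteq> y \<Longrightarrow> 0 \<le> q x y"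
  shows "\<exists>b\<ge>0. \<forall>x\<in>L. q x summable_on (insert c L - {x}) \<and>
    (\<Sum>\<^sub>\<infinity>y\<in>insert c L - {x}. q x y) \<le> b"
proof -
  define b where "b = enn2real (max_exit_rate L c q)"
  have b: "max_exit_rate L c q = ennreal b"
    using assms(1) by (simp add: b_def)
  have "0 \<le> b" by (simp add: b_def)
  have sums: "sum (q x) F \<le> b" if x: "x \<in> L" and F: "finite F" "F \<subseteq> insert c L - {x}" for x F
  proof -
    have "ennreal (sum (q x) F) = (\<Sum>y\<in>F. ennreal (q x y))"
      using F nonneg[OF x] by (intro sum_ennreal[symmetric]) auto
    also have "\<dots> \<le> (\<Sum>\<^sub>\<infinity>y\<in>insert c L - {x}. ennreal (q x y))"
      using F by (subst nonneg_infsum_complete) (auto intro!: SUP_upper)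
    also have "\<dots> \<le> max_exit_rate L c q"
      unfolding max_exit_rate_def by (rule SUP_upper[OF x])
    finally show ?thesis using b \<open>0 \<le> b\<close> by simp
  qed
  have summable: "q x summable_on (insert c L - {x})" if x: "x \<in> L" for x
    using sums[OF x] nonneg[OF x]
    by (intro nonneg_bdd_above_summable_on bdd_aboveI2[where M = b]) auto
  moreover have "(\<Sum>\<^sub>\<infinity>y\<in>insert c L - {x}. q x y) \<le> b" if x: "x \<in> L" for x
    by (rule infsum_le_finite_sums[OF summable[OF x] sums[OF x]])
  ultimately show ?thesis using \<open>0 \<le> b\<close> by blast
qed

text \<open>
  A finite partial sum of the ergodicity coefficient already exceeds the maximal absorbing rate. The
  infima are truncated at \<open>C + 1\<close>, because an infimum is infinite when \<open>L\<close> is a singleton; the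
  truncation keeps the sum above \<open>C\<close>, since any truncated summand is larger than \<open>C\<close> by itself.
\<close>

lemma finite_minorant_of_rates:
  assumes gap: "ergodicity_coeff L q > max_absorbing_rate L c q"
  shows "\<exists>C\<ge>0. \<exists>F a. (\<forall>x\<in>L. q x c \<le> C) \<and> finite F \<and> F \<subseteq> L \<and> C < sum a F \<and>
    (\<forall>z. a z \<le> C + 1) \<and>
    (\<forall>x\<in>L. \<forall>z\<in>F. x \<noteq> z \<longrightarrow> 0 \<le> q x z \<longrightarrow> a z \<le> q x z)"
proof -
  define C where "C = enn2real (max_absorbing_rate L c q)"
  have C: "max_absorbing_rate L c q = ennreal C"
    using gap by (simp add: C_def less_top[symmetric]) (metis ennreal_enn2real top.not_eq_extremum not_top_less)
  have "0 \<le> C" by (simp add: C_def)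
  have q_C: "q x c \<le> C" if "x \<in> L" for x
  proof -
    have "ennreal (q x c) \<le> ennreal C"
      unfolding C[symmetric] max_absorbing_rate_def by (rule SUP_upper[OF that])
    then show ?thesis using \<open>0 \<le> C\<close> by (simp add: ennreal_le_iff)
  qed
  define I where "I z = (INF x\<in>L - {z}. ennreal (q x z))" for z
  have "ennreal C < (SUP F\<in>{F. finite F \<and> F \<subseteq> L}. sum I F)"
    using gap unfolding C ergodicity_coeff_def I_def[symmetric]
    by (subst (asm) nonneg_infsum_complete) auto
  then obtain F where F: "finite F" "F \<subseteq> L" "ennreal C < sum I F"
    by (auto simp: less_SUP_iff)
  define a where "a z = enn2real (min (I z) (ennreal (C + 1)))" for z
  have a: "ennreal (a z) = min (I z) (ennreal (C + 1))" for z
    unfolding a_def by (rule ennreal_enn2real) (simp add: min_less_iff_disj)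
  have "ennreal C < ennreal (sum a F)"
  proof (cases "\<exists>z\<in>F. ennreal (C + 1) \<le> I z")
    case True
    then obtain z where z: "z \<in> F" "ennreal (C + 1) \<le> I z" by blast
    have "ennreal C < ennreal (C + 1)" using \<open>0 \<le> C\<close> by (simp add: ennreal_less_iff)
    also have "\<dots> = ennreal (a z)" using z by (simp add: a min_def)
    also have "\<dots> \<le> ennreal (sum a F)"
      using F z by (intro ennreal_leI member_le_sum) (auto simp: a_def)
    finally show ?thesis .
  next
    case False
    have "sum I F = (\<Sum>z\<in>F. ennreal (a z))"
      using False by (intro sum.cong refl) (auto simp: a min_def)
    also have "\<dots> = ennreal (sum a F)" by (intro sum_ennreal) (auto simp: a_def)
    finally show ?thesis using F by simp
  qed
  then have "C < sum a F" using \<open>0 \<le> C\<close> by (simp add: ennreal_less_iff)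
  moreover have "a z \<le> C + 1" for z
  proof -
    have "ennreal (a z) \<le> ennreal (C + 1)" unfolding a by (rule min.cobounded2)
    then show ?thesis using \<open>0 \<le> C\<close> by (simp only: ennreal_le_iff)
  qed
  moreover have "a z \<le> q x z" if "x \<in> L" "z \<in> F" "x \<noteq> z" "0 \<le> q x z" for x z
  proof -
    have "I z \<le> ennreal (q x z)"
      unfolding I_def using that by (intro INF_lower) auto
    then have "ennreal (a z) \<le> ennreal (q x z)" by (simp add: a min.coboundedI1)
    then show ?thesis using that by (simp add: ennreal_le_iff)
  qed
  ultimately show ?thesis
    using \<open>0 \<le> C\<close> q_C F by (intro exI[of _ C] exI[of _ F] exI[of _ a] conjI) auto
qed

theorem theorem1p1:
  fixes L :: "'a set" and c :: 'a
    and Pr :: "'a \<Rightarrow> 'w measure" and Z :: "real \<Rightarrow> 'w \<Rightarrow> 'a"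
    and q :: "'a \<Rightarrow> 'a \<Rightarrow> real"
  assumes "countable L" and "c \<notin> L"
    and "regular_jump_markov_process (insert c L) Pr Z"
    and "transition_rates (insert c L) Pr Z q"
    and "\<forall>x\<in>L. q c x = 0"
    and "max_exit_rate L c q < \<infinity>"
    and "\<forall>x\<in>L. \<forall>y\<in>L. \<forall>t>0. trans_prob Pr Z t x y > 0"
    and "\<forall>x\<in>insert c L. AE \<omega> in Pr x. absorption_time c Z \<omega> < \<infinity>"
    and "ergodicity_coeff L q > max_absorbing_rate L c q"
  shows "\<exists>\<nu>. quasi_stationary L c (trans_prob Pr Z) \<nu> \<and>
           (\<forall>\<nu>'. quasi_stationary L c (trans_prob Pr Z) \<nu>' \<longrightarrow> \<nu>' = \<nu>) \<and>
           (\<forall>\<mu>. set_pmf \<mu> \<subseteq> L \<longrightarrow> yaglom_limit L c (trans_prob Pr Z) \<mu> \<nu>)"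
proof -
  define E where "E = insert c L"
  define K where "K = transition_law Pr Z"
  have E: "countable E" and process: "regular_jump_markov_process E Pr Z"
    using assms by (auto simp: E_def)
  have LE: "x \<in> E" if "x \<in> L" for x using that by (simp add: E_def)
  have cE: "c \<in> E" by (simp add: E_def)
  have pmf_K: "pmf (K t x) y = trans_prob Pr Z t x y" if "x \<in> E" "0 \<le> t" for t x y
    unfolding K_def by (rule pmf_transition_law[OF E process that])
  have row: "q x x = - (\<Sum>\<^sub>\<infinity>y\<in>E - {x}. q x y)" if "x \<in> E" for x
    using assms(4) that unfolding transition_rates_def E_def by blast
  interpret differentiable_semigroup E K q
  proof
    fix x y assume xy: "x \<in> E" "y \<in> E"
    have "((\<lambda>t. trans_prob Pr Z t x y) has_real_derivative q x y) (at 0 within {0..})"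
      using assms(4) xy unfolding transition_rates_def E_def by blast
    then show "((\<lambda>t. pmf (K t x) y) has_real_derivative q x y) (at 0 within {0..})"
      by (rule has_field_derivative_transform_within[where d = 1]) (use xy in \<open>auto simp: pmf_K\<close>)
  qed (auto simp: K_def transition_law_0[OF E process] transition_law_add[OF E process])
  \<comment> \<open>The row of \<open>c\<close> vanishes, including its diagonal, so the exponential bound on the diagonal entry
    makes \<open>c\<close> absorbing.\<close>
  have "q c c = 0"
    using row[OF cE] assms(2,5) by (simp add: E_def insert_Diff_if infsum_0)
  have absorbing: "K t c = return_pmf c" if "0 \<le> t" for t
  proof -
    have "1 \<le> pmf (K t c) c"
      using diag_ge_exp[OF cE that] \<open>q c c = 0\<close> by simp
    then have "pmf (K t c) c = 1" using pmf_le_1[of "K t c" c] by linarith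
    then have "set_pmf (K t c) \<subseteq> {c}"
      using measure_pmf.prob_eq_1[of "{c}" "K t c"]
      by (auto simp: measure_pmf_single AE_measure_pmf_iff)
    then show ?thesis by (simp add: set_pmf_subset_singleton)
  qed
  have survival: "pmf (K t x) c < 1" if x: "x \<in> L" and t: "0 \<le> t" for x t
  proof -
    have "x \<noteq> c" using x assms(2) by auto
    then have "pmf (K t x) x + pmf (K t x) c = measure_pmf.prob (K t x) {x, c}"
      by (simp add: measure_measure_pmf_finite)
    also have "\<dots> \<le> 1" by simp
    finally show ?thesis using diag_pos[OF LE[OF x] t] by linarith
  qed
  interpret absorbed_semigroup L c K
  proof
    show "set_pmf (K t x) \<subseteq> insert c L" if "x \<in> L" "0 \<le> t" for x t
      using set_transition_law[OF E process LE[OF that(1)] that(2)] by (simp add: K_def E_def)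
  qed (use K_add LE absorbing survival in auto)

  have nonneg: "0 \<le> q x y" if "x \<in> L" "y \<in> insert c L" "x \<noteq> y" for x y
    using that by (intro rate_nonneg) (auto simp: E_def)
  obtain b where b: "0 \<le> b" and summable: "\<And>x. x \<in> L \<Longrightarrow> q x summable_on (E - {x})"
    and row_le: "\<And>x. x \<in> L \<Longrightarrow> (\<Sum>\<^sub>\<infinity>y\<in>E - {x}. q x y) \<le> b"
    using summable_rates[of L c q, OF assms(6) nonneg] unfolding E_def by blast
  have diag_le: "- q x x \<le> b" if "x \<in> E" for x
    using that row[OF that] row_le[of x] b \<open>q c c = 0\<close> by (auto simp: E_def)
  obtain C F a where C: "0 \<le> C" "\<forall>x\<in>L. q x c \<le> C"
    and F: "finite F" "F \<subseteq> L" "C < sum a F" and a: "\<forall>z. a z \<le> C + 1"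
    "\<forall>x\<in>L. \<forall>z\<in>F. x \<noteq> z \<longrightarrow> 0 \<le> q x z \<longrightarrow> a z \<le> q x z"
    using finite_minorant_of_rates[OF assms(9)] by blast
  \<comment> \<open>To first order in \<open>h\<close> the minorant has mass \<open>h * sum a F\<close> and the killing probability is at most
    \<open>h * C\<close>; divided by \<open>h\<close>, the actual bounds stay in this order when \<open>h\<close> is small. The condition
    \<open>h < 1 / (C + 1)\<close> lets the diagonal entries, which are close to one, dominate \<open>h * a z\<close>.\<close>
  have "((\<lambda>h. exp (- (b * h)) * sum a F - (C + h * b\<^sup>2)) \<longlongrightarrow> exp (- (b * 0)) * sum a F - (C + 0 * b\<^sup>2)) (at_right 0)"
    by (intro tendsto_intros)
  then have "\<forall>\<^sub>F h in at_right 0. 0 < exp (- (b * h)) * sum a F - (C + h * b\<^sup>2)"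
    using F by (intro order_tendstoD(1)) auto
  moreover have "\<forall>\<^sub>F h in at_right 0. h < 1 / (C + 1)"
    using C by (intro eventually_at_right_real[THEN eventually_mono]) auto
  moreover have "\<forall>\<^sub>F h::real in at_right 0. 0 < h"
    by (simp add: eventually_at_right_less)
  ultimately have "\<forall>\<^sub>F h in at_right 0. 0 < h \<and> h < 1 / (C + 1) \<and>
      0 < exp (- (b * h)) * sum a F - (C + h * b\<^sup>2)"
    by eventually_elim auto
  then obtain h where h: "0 < h" "h < 1 / (C + 1)" "0 < exp (- (b * h)) * sum a F - (C + h * b\<^sup>2)"
    by (metis (mono_tags, lifting) eventually_happens trivial_limit_at_right_real)
  define \<beta> where "\<beta> z = h * exp (- (b * h)) * a z" for z
  define \<epsilon> where "\<epsilon> = h * C + h\<^sup>2 * b\<^sup>2"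
  have minor: "\<beta> z \<le> pmf (K h x) z" if x: "x \<in> L" and z: "z \<in> F" for x z
  proof (cases "x = z")
    case True
    have "h * (C + 1) \<le> 1" using h C by (simp add: field_simps)
    with mult_left_mono[OF spec[OF a(1), of z], of h] h have "h * a z \<le> 1" by linarith
    then have "\<beta> z \<le> exp (- (b * h))"
      using mult_right_mono[of "h * a z" 1 "exp (- (b * h))"] by (simp add: \<beta>_def algebra_simps)
    also have "\<dots> \<le> exp (h * q x x)"
      using mult_left_mono[OF diag_le[OF LE[OF x]], of h] h by (simp add: algebra_simps)
    also have "\<dots> \<le> pmf (K h x) z"
      using diag_ge_exp[OF LE[OF x], of h] h True by simp
    finally show ?thesis .
  next
    case False
    have zL: "z \<in> L" using z F by auto
    have "a z \<le> q x z" using a(2) nonneg[of x z] x z zL False by auto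
    then have "\<beta> z \<le> h * exp (- (b * h)) * q x z"
      unfolding \<beta>_def using h by (intro mult_left_mono) auto
    also have "\<dots> \<le> pmf (K h x) z"
      using x zL False h by (intro off_diag_ge diag_le LE) auto
    finally show ?thesis .
  qed
  have kill: "pmf (K h x) c \<le> \<epsilon>" if x: "x \<in> L" for x
  proof -
    have "pmf (K h x) c \<le> h * q x c + h\<^sup>2 * b\<^sup>2"
      using x assms(2)
      by (intro hitting_prob_le[OF LE[OF x] cE _ diag_le summable[OF x] row[OF LE[OF x]] h(1)]) auto
    also have "\<dots> \<le> \<epsilon>" unfolding \<epsilon>_def using C(2) x h by simp
    finally show ?thesis .
  qed
  have gap: "\<epsilon> < sum \<beta> F"
  proof -
    have "h * (C + h * b\<^sup>2) < h * (exp (- (b * h)) * sum a F)"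
      using h by (intro mult_strict_left_mono) auto
    moreover have "sum \<beta> F = h * exp (- (b * h)) * sum a F"
      unfolding \<beta>_def by (rule sum_distrib_left[symmetric])
    ultimately show ?thesis
      by (simp add: \<epsilon>_def algebra_simps power2_eq_square)
  qed
  have "L \<noteq> {}"
  proof
    assume "L = {}"
    then have "sum a F = 0" using F by simp
    with F C show False by simp
  qed
  moreover have "c \<notin> F" using F assms(2) by auto
  ultimately obtain \<nu> where \<nu>: "set_pmf \<nu> \<subseteq> L" "\<And>t. 0 \<le> t \<Longrightarrow> \<phi> t \<nu> = \<nu>"
    "\<And>\<mu> y. set_pmf \<mu> \<subseteq> L \<Longrightarrow> ((\<lambda>t. pmf (\<phi> t \<mu>) y) \<longlongrightarrow> pmf \<nu> y) at_top"
    using quasi_limiting_law[OF _ h(1) F(1) _ minor kill gap] by blast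
  have cond: "conditioned_law L c (trans_prob Pr Z) \<mu> t x = pmf (\<phi> t \<mu>) x"
    if "set_pmf \<mu> \<subseteq> L" "x \<in> L" "0 \<le> t" for \<mu> t x
    using that assms(2) survival by (intro conditioned_law_eq) (auto simp: pmf_K LE)
  have yaglom: "yaglom_limit L c (trans_prob Pr Z) \<mu> \<nu>" if \<mu>: "set_pmf \<mu> \<subseteq> L" for \<mu>
    unfolding yaglom_limit_def
  proof (intro conjI ballI \<nu>(1))
    fix y assume y: "y \<in> L"
    have "\<forall>\<^sub>F t in at_top. pmf (\<phi> t \<mu>) y = conditioned_law L c (trans_prob Pr Z) \<mu> t y"
      using eventually_ge_at_top[of 0] by eventually_elim (simp add: cond \<mu> y)
    then show "((\<lambda>t. conditioned_law L c (trans_prob Pr Z) \<mu> t y) \<longlongrightarrow> pmf \<nu> y) at_top"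
      by (rule Lim_transform_eventually[OF \<nu>(3)[OF \<mu>]])
  qed
  have "quasi_stationary L c (trans_prob Pr Z) \<nu>"
    unfolding quasi_stationary_def using \<nu> cond by auto
  moreover have "\<nu>' = \<nu>" if "quasi_stationary L c (trans_prob Pr Z) \<nu>'" for \<nu>'
  proof (rule pmf_eqI)
    fix y
    have supp: "set_pmf \<nu>' \<subseteq> L"
      and stat: "\<And>t x. 0 \<le> t \<Longrightarrow> x \<in> L \<Longrightarrow> conditioned_law L c (trans_prob Pr Z) \<nu>' t x = pmf \<nu>' x"
      using that unfolding quasi_stationary_def by auto
    show "pmf \<nu>' y = pmf \<nu> y"
    proof (cases "y \<in> L")
      case True
      have "((\<lambda>t. conditioned_law L c (trans_prob Pr Z) \<nu>' t y) \<longlongrightarrow> pmf \<nu> y) at_top"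
        using yaglom[OF supp] True unfolding yaglom_limit_def by blast
      moreover have "\<forall>\<^sub>F t in at_top. conditioned_law L c (trans_prob Pr Z) \<nu>' t y = pmf \<nu>' y"
        using eventually_ge_at_top[of 0] by eventually_elim (simp add: stat True)
      ultimately have "((\<lambda>t::real. pmf \<nu>' y) \<longlongrightarrow> pmf \<nu> y) at_top"
        by (rule Lim_transform_eventually)
      then show ?thesis by (simp add: tendsto_const_iff)
    next
      case False
      then have "pmf \<nu>' y = 0" "pmf \<nu> y = 0"
        using supp \<nu>(1) by (auto simp: pmf_eq_0_set_pmf)
      then show ?thesis by simp
    qed
  qed
  ultimately show ?thesis using yaglom by blast
qed

end
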